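(* Let $\mu$ be an $n$-dimensional Radon measure on $\mathbb{R}^d$ ($n\in\mathbb{R}$, $0<n\le d$). Let $T$ be a Calderón-Zygmund operator on $\mathbb{R}^d$ with respect to $\mu$ having an $n$-dimensional, $\epsilon$-regular, standard kernel $K$, and let $0<\alpha<\epsilon\le 1$. Then $T$ (extended to Lipschitz functions, with values modulo constants) is bounded on $\mathcal{L}ip(\alpha,\mu)$ if and only if $T(1)=0$ in $\mathcal{L}ip(\alpha,\mu)$.
   Context: A Radon measure $\mu$ on $\mathbb{R}^d$ is called $n$-dimensional if there is a constant $C$ such that $\mu(B(x,r))\le C r^n$ for every ball $B(x,r)$ with $x\in\mathbb{R}^d$, $r>0$; $\mu$ need not be doubling. All balls below are Euclidean balls of positive radius centered at points of the support of $\mu$; for $B=B(x,r)$, $2B=B(x,2r)$. Lipschitz space. For $0<\alpha\le 1$, a function $f\in L^1_{\mathrm{loc}}(\mu)$ (or rather its Lebesgue class) is Lipschitz of order $\alpha$ with respect to $\mu$ if there is a constant $C_2$ such that $|f(x)-f(y)|\le C_2|x-y|^\alpha$ for $\mu$-almost every $x$ and $y$ in the support of $\mu$ (i.e. for all $x,y$ in the support outside some $\mu$-null set). $\mathcal{L}ip(\alpha,\mu)$ is the Banach space of all such functions modulo constants, with norm $\|f\|_{\mathcal{L}ip(\alpha,\mu)}=\inf C_2$. Kernels. An $n$-dimensional, $\epsilon$-regular, standard kernel ($\epsilon\in(0,1]$) is a function $K\in L^1_{\mathrm{loc}}(\mathbb{R}^d\times\mathbb{R}^d\setminus\{(x,y):x=y\},\mu\times\mu)$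 such that, for some constant $C>0$: (i) $|K(x,y)|\le \dfrac{C}{|x-y|^n}$ for all $x\ne y$; (ii) $|K(x,y)-K(x',y)|\le C\dfrac{|x-x'|^\epsilon}{|x-y|^{n+\epsilon}}$ whenever $x\neq y$ and $|x-y|\ge 2|x-x'|$. No regularity in the second variable is required. Calderón-Zygmund operators. A Calderón-Zygmund operator on $\mathbb{R}^d$ with respect to $\mu$ is a linear operator $T$, bounded on $L^2(\mu)$, associated to an $n$-dimensional standard kernel $K$ in the sense that for every $f\in L^2(\mu)$ with compact support, $Tf(x)=\int_{\mathbb{R}^d}K(x,y)f(y)\,d\mu(y)$ for $\mu$-almost every $x\in\mathbb{R}^d\setminus\operatorname{supp} f$. Extension to Lipschitz functions. Let $T$ be a Calderón-Zygmund operator on $\mathbb{R}^d$ with respect to $\mu$, associated to an $n$-dimensional, $\epsilon$-regular, standard kernel $K$, let $0<\alpha<\epsilon$ and let $f$ be a Lipschitz function of order $\alpha$ with respect to $\mu$ (constants, such as $f=1$, included). For each ball $B$ with center $x_B$ and $x\in B$ define $$T_B(f)(x)=T(f\chi_{2B})(x)+\int_{\mathbb{R}^d\setminus 2B}\bigl(K(x,z)-K(x_B,z)\bigr)f(z)\,d\mu(z).$$ Then $T(f)$ is defined as the class of all functions $g$ on $\mathbb{R}^d$ such that for any ball $B$ there is a constant $c_B$ with $g(x)=T_B(f)(x)+c_B$ for $\mu$-almost every $x\in B$. This class is well defined: such $g$ exist and are determined up to additive constants ($\mu$-a.e.). "$T(1)=0$ in $\mathcal{L}ip(\alpha,\mu)$"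 means that $T(1)$, for the constant function $1$, is the class of functions that are $\mu$-a.e. constant. "$T$ is bounded on $\mathcal{L}ip(\alpha,\mu)$" means that there is a constant $C$ such that for every function $f$ that is Lipschitz of order $\alpha$ with respect to $\mu$, $T(f)\in\mathcal{L}ip(\alpha,\mu)$ and $\|T(f)\|_{\mathcal{L}ip(\alpha,\mu)}\le C\|f\|_{\mathcal{L}ip(\alpha,\mu)}$ (where constant functions have $\|\cdot\|_{\mathcal{L}ip(\alpha,\mu)}=0$). *)

theory Defs
  imports "HOL-Analysis.Analysis"
begin

text \<open>
  The scalars form a type \<open>'k :: {real_normed_field, banach, second_countable_topology}\<close>, which
  covers both real- and complex-valued functions. Elements of Lebesgue classes are represented by
  Borel measurable functions.
\<close>

definition radon_measure :: "'a::euclidean_space measure \<Rightarrow> bool" where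
  "radon_measure \<mu> \<longleftrightarrow>
     sets \<mu> = sets borel \<and>
     (\<forall>S. compact S \<longrightarrow> emeasure \<mu> S < \<infinity>) \<and>
     (\<forall>A\<in>sets borel. emeasure \<mu> A = (SUP S\<in>{S. compact S \<and> S \<subseteq> A}. emeasure \<mu> S))"

definition n_dimensional :: "real \<Rightarrow> 'a::euclidean_space measure \<Rightarrow> bool" where
  "n_dimensional n \<mu> \<longleftrightarrow>
     (\<exists>C::real. \<forall>x r. r > 0 \<longrightarrow> emeasure \<mu> (ball x r) \<le> ennreal (C * r powr n))"

definition msupport :: "'a::euclidean_space measure \<Rightarrow> 'a set" where
  "msupport \<mu> = {x. \<forall>r>0. emeasure \<mu> (ball x r) > 0}"

text \<open>\<open>L\<^sup>1\<^sub>l\<^sub>o\<^sub>c(\<Omega>, M)\<close> for an open set \<open>\<Omega>\<close>; values of \<open>f\<close> outside \<open>\<Omega>\<close> are irrelevant.\<close>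

definition loc_integrable_on ::
  "'b::topological_space measure \<Rightarrow> 'b set
     \<Rightarrow> ('b \<Rightarrow> 'k::{banach, second_countable_topology}) \<Rightarrow> bool" where
  "loc_integrable_on M \<Omega> f \<longleftrightarrow>
     set_borel_measurable M \<Omega> f \<and> (\<forall>S. compact S \<and> S \<subseteq> \<Omega> \<longrightarrow> set_integrable M S f)"

definition lip_bound ::
  "real \<Rightarrow> 'a::euclidean_space measure \<Rightarrow> ('a \<Rightarrow> 'k::real_normed_vector) \<Rightarrow> real \<Rightarrow> bool" where
  "lip_bound \<alpha> \<mu> f C \<longleftrightarrow>
     (\<exists>N\<in>null_sets \<mu>. \<forall>x\<in>msupport \<mu> - N. \<forall>y\<in>msupport \<mu> - N.
        norm (f x - f y) \<le> C * dist x y powr \<alpha>)"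

definition lip_functions ::
  "real \<Rightarrow> 'a::euclidean_space measure
     \<Rightarrow> ('a \<Rightarrow> 'k::{banach, second_countable_topology}) set" where
  "lip_functions \<alpha> \<mu> = {f. loc_integrable_on \<mu> UNIV f \<and> (\<exists>C\<ge>0. lip_bound \<alpha> \<mu> f C)}"

text \<open>The class of \<open>f\<close> modulo constants (and modulo \<open>\<mu>\<close>-null sets).\<close>

definition mod_const ::
  "'a::euclidean_space measure \<Rightarrow> ('a \<Rightarrow> 'k::real_normed_vector) \<Rightarrow> ('a \<Rightarrow> 'k) set" where
  "mod_const \<mu> f = {g \<in> borel_measurable \<mu>. \<exists>c. AE x in \<mu>. g x = f x + c}"

definition Lip ::
  "real \<Rightarrow> 'a::euclidean_space measure
     \<Rightarrow> ('a \<Rightarrow> 'k::{banach, second_countable_topology}) set set" where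
  "Lip \<alpha> \<mu> = mod_const \<mu> ` lip_functions \<alpha> \<mu>"

text \<open>
  The norm of a class in \<open>Lip \<alpha> \<mu>\<close>. The admissible constants do not depend on the
  representative \<open>f\<close> of the class.
\<close>

definition lip_norm ::
  "real \<Rightarrow> 'a::euclidean_space measure \<Rightarrow> ('a \<Rightarrow> 'k::real_normed_vector) set \<Rightarrow> real" where
  "lip_norm \<alpha> \<mu> F = Inf {C. C \<ge> 0 \<and> (\<exists>f\<in>F. lip_bound \<alpha> \<mu> f C)}"

definition standard_kernel ::
  "real \<Rightarrow> real \<Rightarrow> 'a::euclidean_space measure
     \<Rightarrow> ('a \<Rightarrow> 'a \<Rightarrow> 'k::{real_normed_field, banach, second_countable_topology}) \<Rightarrow> bool" where
  "standard_kernel n \<epsilon> \<mu> K \<longleftrightarrow>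
     loc_integrable_on (\<mu> \<Otimes>\<^sub>M \<mu>) {(x, y). x \<noteq> y} (\<lambda>(x, y). K x y) \<and>
     (\<exists>C>0.
        (\<forall>x y. x \<noteq> y \<longrightarrow> norm (K x y) \<le> C / dist x y powr n) \<and>
        (\<forall>x x' y. x \<noteq> y \<and> dist x y \<ge> 2 * dist x x' \<longrightarrow>
           norm (K x y - K x' y) \<le> C * (dist x x' powr \<epsilon> / dist x y powr (n + \<epsilon>))))"

definition L2 ::
  "'a::euclidean_space measure \<Rightarrow> ('a \<Rightarrow> 'k::real_normed_vector) set" where
  "L2 \<mu> = {f \<in> borel_measurable \<mu>. integrable \<mu> (\<lambda>x. (norm (f x))\<^sup>2)}"

definition L2_norm ::
  "'a::euclidean_space measure \<Rightarrow> ('a \<Rightarrow> 'k::real_normed_vector) \<Rightarrow> real" where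
  "L2_norm \<mu> f = sqrt (\<integral>x. (norm (f x))\<^sup>2 \<partial>\<mu>)"

text \<open>
  An operator on \<open>L\<^sup>2(\<mu>)\<close> acts on representatives, its values being meaningful only up to
  \<open>\<mu>\<close>-null sets. Linearity together with boundedness makes it respect equality \<open>\<mu>\<close>-a.e.
\<close>

definition bounded_linear_L2 ::
  "'a::euclidean_space measure
     \<Rightarrow> (('a \<Rightarrow> 'k::{real_normed_field, banach, second_countable_topology}) \<Rightarrow> 'a \<Rightarrow> 'k) \<Rightarrow> bool"
  where
  "bounded_linear_L2 \<mu> T \<longleftrightarrow>
     (\<forall>f\<in>L2 \<mu>. T f \<in> L2 \<mu>) \<and>
     (\<forall>f\<in>L2 \<mu>. \<forall>g\<in>L2 \<mu>. AE x in \<mu>. T (\<lambda>y. f y + g y) x = T f x + T g x) \<and>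
     (\<forall>f\<in>L2 \<mu>. \<forall>c. AE x in \<mu>. T (\<lambda>y. c * f y) x = c * T f x) \<and>
     (\<exists>C. \<forall>f\<in>L2 \<mu>. L2_norm \<mu> (T f) \<le> C * L2_norm \<mu> f)"

definition fsupport :: "('a::topological_space \<Rightarrow> 'k::zero) \<Rightarrow> 'a set" where
  "fsupport f = closure {x. f x \<noteq> 0}"

definition cz_operator ::
  "real \<Rightarrow> real \<Rightarrow> 'a::euclidean_space measure
     \<Rightarrow> ('a \<Rightarrow> 'a \<Rightarrow> 'k::{real_normed_field, banach, second_countable_topology})
     \<Rightarrow> (('a \<Rightarrow> 'k) \<Rightarrow> 'a \<Rightarrow> 'k) \<Rightarrow> bool" where
  "cz_operator n \<epsilon> \<mu> K T \<longleftrightarrow>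
     bounded_linear_L2 \<mu> T \<and>
     standard_kernel n \<epsilon> \<mu> K \<and>
     (\<forall>f\<in>L2 \<mu>. compact (fsupport f) \<longrightarrow>
        (AE x in \<mu>. x \<notin> fsupport f \<longrightarrow> T f x = (\<integral>y. K x y * f y \<partial>\<mu>)))"

text \<open>\<open>T\<^sub>B(f)\<close> for the ball \<open>B = ball x\<^sub>B r\<close>; meaningful for \<open>x \<in> B\<close>.\<close>

definition cz_ball ::
  "'a::euclidean_space measure
     \<Rightarrow> ('a \<Rightarrow> 'a \<Rightarrow> 'k::{real_normed_field, banach, second_countable_topology})
     \<Rightarrow> (('a \<Rightarrow> 'k) \<Rightarrow> 'a \<Rightarrow> 'k) \<Rightarrow> ('a \<Rightarrow> 'k) \<Rightarrow> 'a \<Rightarrow> real \<Rightarrow> 'a \<Rightarrow> 'k" where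
  "cz_ball \<mu> K T f x\<^sub>B r x =
     T (\<lambda>z. indicator (ball x\<^sub>B (2 * r)) z *\<^sub>R f z) x +
     (LINT z:UNIV - ball x\<^sub>B (2 * r)|\<mu>. (K x z - K x\<^sub>B z) * f z)"

text \<open>The class \<open>T(f)\<close> for a Lipschitz function \<open>f\<close>.\<close>

definition cz_ext ::
  "'a::euclidean_space measure
     \<Rightarrow> ('a \<Rightarrow> 'a \<Rightarrow> 'k::{real_normed_field, banach, second_countable_topology})
     \<Rightarrow> (('a \<Rightarrow> 'k) \<Rightarrow> 'a \<Rightarrow> 'k) \<Rightarrow> ('a \<Rightarrow> 'k) \<Rightarrow> ('a \<Rightarrow> 'k) set" where
  "cz_ext \<mu> K T f =
     {g \<in> borel_measurable \<mu>. \<forall>x\<^sub>B\<in>msupport \<mu>. \<forall>r>0. \<exists>c.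
        AE x in \<mu>. x \<in> ball x\<^sub>B r \<longrightarrow> g x = cz_ball \<mu> K T f x\<^sub>B r x + c}"

definition bounded_on_Lip ::
  "real \<Rightarrow> 'a::euclidean_space measure
     \<Rightarrow> ('a \<Rightarrow> 'a \<Rightarrow> 'k::{real_normed_field, banach, second_countable_topology})
     \<Rightarrow> (('a \<Rightarrow> 'k) \<Rightarrow> 'a \<Rightarrow> 'k) \<Rightarrow> bool" where
  "bounded_on_Lip \<alpha> \<mu> K T \<longleftrightarrow>
     (\<exists>C. \<forall>f\<in>lip_functions \<alpha> \<mu>.
        cz_ext \<mu> K T f \<in> Lip \<alpha> \<mu> \<and>
        lip_norm \<alpha> \<mu> (cz_ext \<mu> K T f) \<le> C * lip_norm \<alpha> \<mu> (mod_const \<mu> f))"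

end

theory Submission
  imports Defs
begin

text \<open>
  If \<open>T\<close> is bounded, then \<open>T(1)\<close> has norm \<open>0\<close>, so it is constant. Conversely, let \<open>T(1) = 0\<close> and let
  \<open>c\<^sub>B\<close> be the constant value of \<open>T\<^sub>B(1)\<close> on \<open>B\<close>. The point is that \<open>K(x,z) (f(z) - f(x))\<close> is integrable
  near \<open>x\<close> and that the commutator of \<open>T\<close> with multiplication by \<open>f\<close> is the integral operator with this
  kernel: the difference of the two is local and has norm \<open>O(\<delta>\<^sup>\<alpha>)\<close> on sets of diameter \<open>\<delta>\<close>, hence
  vanishes. This gives, with no differentiation theorem for \<open>\<mu>\<close>,
  \<open>T\<^sub>B f(x) = c\<^sub>B f(x) + \<integral> (K(x,z) - \<chi>(z) K(x\<^sub>B,z)) (f(z) - f(x)) d\<mu>(z)\<close>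
  where \<open>\<chi>\<close> is the indicator function of the complement of \<open>2B\<close>. On a ball of radius \<open>r\<close> the integral
  is \<open>O(r\<^sup>\<alpha>)\<close>, so it remains to bound \<open>c\<^sub>B\<close> uniformly. For doubling balls this follows from the
  \<open>L\<^sup>2\<close> bound; any other ball is dilated to the first doubling one, and the increments of
  \<open>c\<^sub>B\<close> along the way are summable because the densities \<open>\<mu>(B)/r\<^sup>n\<close> grow geometrically.
\<close>

subsection \<open>Measures of polynomial growth\<close>

text \<open>K(x, .) need not be integrable near x, so neither T(f) nor T(1) is a convergent integral
  in general, and the L2 bound controls averages over B only through \<mu>(2B)/\<mu>(B), which is
  unbounded for a nondoubling measure. In the commutator argument this ratio never enters: the
  defect of a piece of P is integrated over P itself and not over a dilate, so that each term costs
  a multiple of \<delta>^\<alpha> \<mu>(P), and disjoint pieces add up to the mass of a bounded set.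
  Since T is a kernel integral only off closed supports, the pieces need null boundaries; balls with
  null spheres provide them. The constants c_B matter because comparing T(f) at x and y through one
  ball leaves the term c_B (f(x) - f(y)), for arbitrarily small and arbitrarily nondoubling balls.
  Passing from B to 2B changes c_B by the integral of K(x_B, z) over 4B - 2B, hence by at most a
  multiple of \<mu>(4B)/r^n, where r is the radius of B. Finally, a change of ball adds to the
  formula for T_B(f) an integral that does not depend on x. This glues the local formulas into one
  representative of T(f), and allows any pair x, y to be compared in a ball of radius comparable to
  |x - y|.\<close>

lemma integrable_from_nn_bound:
  fixes u :: "'a \<Rightarrow> real"
  assumes "u \<in> borel_measurable M" "\<And>x. 0 \<le> u x" "(\<integral>\<^sup>+x. ennreal (u x) \<partial>M) \<le> ennreal c" "0 \<le> c"
  shows "integrable M u" "(\<integral>x. u x \<partial>M) \<le> c"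
proof -
  show i: "integrable M u"
    by (rule integrableI_nonneg) (use assms in \<open>auto intro: le_less_trans\<close>)
  have "ennreal (\<integral>x. u x \<partial>M) \<le> ennreal c"
    using nn_integral_eq_integral[OF i] assms by auto
  then show "(\<integral>x. u x \<partial>M) \<le> c" using assms(4) by simp
qed

lemma integrable_dominated:
  fixes f :: "'a \<Rightarrow> 'b::{banach, second_countable_topology}" and u :: "'a \<Rightarrow> real"
  assumes "integrable M u" "f \<in> borel_measurable M" "AE x in M. norm (f x) \<le> u x"
  shows "integrable M f" "norm (\<integral>x. f x \<partial>M) \<le> (\<integral>x. u x \<partial>M)"
proof -
  show i: "integrable M f"
    by (rule Bochner_Integration.integrable_bound[OF assms(1,2)]) (use assms(3) in \<open>auto elim: eventually_mono\<close>)
  have "norm (\<integral>x. f x \<partial>M) \<le> (\<integral>x. norm (f x) \<partial>M)" by (rule integral_norm_bound)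
  also have "\<dots> \<le> (\<integral>x. u x \<partial>M)"
    by (rule integral_mono_AE) (use i assms in auto)
  finally show "norm (\<integral>x. f x \<partial>M) \<le> (\<integral>x. u x \<partial>M)" .
qed

lemma dyadic_scale:
  fixes t :: real assumes "1 \<le> t" shows "\<exists>k::nat. 2 ^ k \<le> t \<and> t < 2 ^ (k+1)"
proof -
  obtain m where m: "t < 2 ^ m" using real_arch_pow[of 2 t] by auto
  define j where "j = (LEAST j. t < 2 ^ j)"
  have j: "t < 2 ^ j" unfolding j_def by (rule LeastI[of _ m]) (rule m)
  have "j \<noteq> 0" using j assms by (metis not_less power_0)
  then obtain k where k: "j = Suc k" by (cases j) auto
  have "\<not> t < 2 ^ k" using not_less_Least[of k "\<lambda>j. t < 2 ^ j"] k unfolding j_def by simp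
  then show ?thesis using j k by (intro exI[of _ k]) auto
qed

lemma power_powr_commute: "0 \<le> b \<Longrightarrow> (b ^ k) powr a = (b powr a) ^ k" for a b :: real
  by (induction k) (auto simp: powr_mult)

lemma suminf_geometric_ennreal:
  fixes c q :: real assumes "0 \<le> c" "0 \<le> q" "q < 1"
  shows "(\<Sum>k. ennreal (c * q ^ k)) = ennreal (c / (1 - q))"
proof -
  have "(\<lambda>k. c * q ^ k) sums (c * (1 / (1 - q)))"
    by (intro sums_mult geometric_sums) (use assms in auto)
  then have s: "(\<lambda>k. c * q ^ k) sums (c / (1 - q))" by simp
  show ?thesis
    by (subst suminf_ennreal2) (use assms s in \<open>auto simp: sums_iff\<close>)
qed

lemma ennreal_le_suminf: "f j \<le> (\<Sum>k. f k)" for f :: "nat \<Rightarrow> ennreal"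
  using sum_le_suminf[OF summableI, of "{j}" f] by simp

text \<open>Every point outside the support has a null ball, hence a null basic open neighbourhood;
  a countable basis makes the union of these null.\<close>

lemma msupport_compl_null:
  fixes \<mu> :: "'a::euclidean_space measure"
  assumes s: "sets \<mu> = sets borel"
  shows "AE x in \<mu>. x \<in> msupport \<mu>"
proof -
  obtain B :: "'a set set" where B: "countable B" "topological_basis B"
    using ex_countable_basis by blast
  define D where "D = {b\<in>B. emeasure \<mu> b = 0}"
  have D: "\<And>b. b \<in> D \<Longrightarrow> b \<in> null_sets \<mu>"
    using B(2) s by (auto simp: D_def null_sets_def topological_basis_open)
  have "countable D" using B(1) by (auto simp: D_def)
  then have "\<Union>D \<in> null_sets \<mu>" using D by (metis UN_I null_sets_UN' image_ident)
  moreover have "x \<in> \<Union>D" if "x \<notin> msupport \<mu>" for x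
  proof -
    from that obtain r where r: "r > 0" "emeasure \<mu> (ball x r) = 0"
      by (auto simp: msupport_def)
    obtain b where b: "b \<in> B" "x \<in> b" "b \<subseteq> ball x r"
      using topological_basisE[OF B(2), of "ball x r" x] r by auto
    have "emeasure \<mu> b \<le> emeasure \<mu> (ball x r)" by (rule emeasure_mono) (use b s in auto)
    then show ?thesis using b r by (auto simp: D_def)
  qed
  ultimately show ?thesis by (intro AE_I'[of "\<Union>D"]) auto
qed

section \<open>The growth condition and the power integrals that it controls\<close>

locale growth_measure =
  fixes \<mu> :: "'a::euclidean_space measure" and n A :: real
  assumes n_pos: "0 < n" and A_nonneg: "0 \<le> A"
    and sets_mu[measurable_cong]: "sets \<mu> = sets borel"
    and growth: "\<And>x r. r > 0 \<Longrightarrow> emeasure \<mu> (ball x r) \<le> ennreal (A * r powr n)"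
begin

lemma space_mu[simp]: "space \<mu> = UNIV"
  using sets_eq_imp_space_eq[OF sets_mu] by simp

lemma ball_sets [measurable, simp]: "ball x r \<in> sets \<mu>"
  by (simp add: sets_mu)

lemma finite_ball: "emeasure \<mu> (ball x r) < \<infinity>"
proof (cases "r > 0")
  case True then show ?thesis using growth[of r x] by (auto intro: le_less_trans)
qed (auto simp: ball_empty)

lemma finite_bounded: "bounded E \<Longrightarrow> emeasure \<mu> E < \<infinity>"
proof -
  assume "bounded E"
  then obtain r where r: "E \<subseteq> ball 0 r" using bounded_subset_ballD[of E 0] by blast
  have "emeasure \<mu> E \<le> emeasure \<mu> (ball 0 r)" by (rule emeasure_mono[OF r]) (simp add: sets_mu)
  then show ?thesis using finite_ball[of 0 r] by (rule le_less_trans)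
qed

lemma sigma_finite: "sigma_finite_measure \<mu>"
proof
  show "\<exists>B. countable B \<and> B \<subseteq> sets \<mu> \<and> \<Union>B = space \<mu> \<and> (\<forall>a\<in>B. emeasure \<mu> a \<noteq> \<infinity>)"
  proof (intro exI[of _ "range (\<lambda>k::nat. ball 0 (real k))"] conjI ballI)
    show "\<Union>(range (\<lambda>k::nat. ball (0::'a) (real k))) = space \<mu>"
      by (auto intro: reals_Archimedean2)
  qed (use finite_ball in \<open>auto simp: sets_mu less_top\<close>)
qed

lemma integrable_indicator_bounded:
  "E \<in> sets borel \<Longrightarrow> bounded E \<Longrightarrow> integrable \<mu> (indicator E :: 'a \<Rightarrow> real)"
  using finite_bounded[of E] by (simp add: sets_mu)

lemma measure_ball_le: "r > 0 \<Longrightarrow> measure \<mu> (ball x r) \<le> A * r powr n"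
  using growth[of r x] A_nonneg by (simp add: measure_def enn2real_leI)

text \<open>Sum over the dyadic shells around \<open>x\<close>: the growth condition bounds the mass
  of a shell by a multiple of its radius to the power n, which cancels the singular factor and
  leaves a geometric series of ratio \<open>q\<close>.\<close>

lemma near_integral:
  assumes \<alpha>: "0 < \<alpha>"
  shows "\<exists>C\<ge>0. \<forall>x \<rho>. 0 < \<rho> \<longrightarrow>
     integrable \<mu> (\<lambda>z. indicator (ball x \<rho>) z * dist x z powr (\<alpha> - n)) \<and>
     (\<integral>z. indicator (ball x \<rho>) z * dist x z powr (\<alpha> - n) \<partial>\<mu>) \<le> C * \<rho> powr \<alpha>"
proof -
  define q where "q = (1/2::real) powr \<alpha>"
  have q: "0 \<le> q" "q < 1"
    using \<alpha> powr_less_mono'[of "1/2::real" 0 \<alpha>] by (auto simp: q_def)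
  define C where "C = 2 powr n * A / (1 - q)"
  have C: "0 \<le> C" using q A_nonneg by (auto simp: C_def)
  have main: "(\<integral>\<^sup>+z. ennreal (indicator (ball x \<rho>) z * dist x z powr (\<alpha> - n)) \<partial>\<mu>) \<le> ennreal (C * \<rho> powr \<alpha>)"
    if \<rho>: "0 < \<rho>" for x \<rho>
  proof -
    define b where "b k = (\<rho> / 2^k) powr \<alpha> * (\<rho> / 2^(k+1)) powr (-n)" for k :: nat
    have b0: "0 \<le> b k" for k by (simp add: b_def)
    have dom: "ennreal (indicator (ball x \<rho>) z * dist x z powr (\<alpha> - n))
        \<le> (\<Sum>k. ennreal (b k) * indicator (ball x (\<rho> / 2^k)) z)" for z
    \<comment> \<open>At \<open>z = x\<close> the left side is 0, because
      \<open>0 powr _ = 0\<close>.\<close>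
    proof (cases "dist x z < \<rho> \<and> z \<noteq> x")
      case True
      define t where "t = dist x z"
      have t: "0 < t" "t < \<rho>" using True by (auto simp: t_def)
      obtain k where k: "2^k \<le> \<rho> / t" "\<rho> / t < 2^(k+1)"
        using dyadic_scale[of "\<rho> / t"] t by auto
      have k': "t \<le> \<rho> / 2^k" "\<rho> / 2^(k+1) < t" using k t by (auto simp: field_simps)
      \<comment> \<open>If \<open>t = \<rho> / 2^k\<close>, the open ball of radius
        \<open>\<rho> / 2^k\<close> misses \<open>z\<close>; such a point is assigned to the next
        larger shell.\<close>
      obtain j where j: "\<rho> / 2^(j+1) \<le> t" "t < \<rho> / 2^j"
      proof (cases "t = \<rho> / 2^k")
        case eq: True
        have "k \<noteq> 0" using eq t by (metis div_by_1 less_irrefl power_0)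
        then obtain i where "k = Suc i" by (cases k) auto
        with eq \<rho> show ?thesis by (intro that[of i]) (auto simp: field_simps)
      next
        case False with k' show ?thesis by (intro that[of k]) auto
      qed
      \<comment> \<open>The exponent \<alpha> - n may have either sign, so the power is split into
        an increasing and a decreasing factor.\<close>
      have "t powr (\<alpha> - n) = t powr \<alpha> * t powr (-n)" by (metis powr_add add_uminus_conv_diff)
      also have "\<dots> \<le> b j" unfolding b_def
        by (intro mult_mono powr_mono2 powr_mono2') (use j t \<rho> \<alpha> n_pos in auto)
      finally have "ennreal (indicator (ball x \<rho>) z * dist x z powr (\<alpha> - n))
          \<le> ennreal (b j) * indicator (ball x (\<rho> / 2^j)) z"
        using j True by (auto simp: t_def ennreal_leI)
      also have "\<dots> \<le> (\<Sum>k. ennreal (b k) * indicator (ball x (\<rho> / 2^k)) z)"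
        by (rule ennreal_le_suminf[where f = "\<lambda>k. ennreal (b k) * indicator (ball x (\<rho> / 2^k)) z"])
      finally show ?thesis .
    qed auto
    have "(\<integral>\<^sup>+z. ennreal (indicator (ball x \<rho>) z * dist x z powr (\<alpha> - n)) \<partial>\<mu>)
        \<le> (\<integral>\<^sup>+z. (\<Sum>k. ennreal (b k) * indicator (ball x (\<rho> / 2^k)) z) \<partial>\<mu>)"
      by (intro nn_integral_mono dom)
    also have "\<dots> = (\<Sum>k. ennreal (b k) * emeasure \<mu> (ball x (\<rho> / 2^k)))"
      by (simp add: nn_integral_suminf nn_integral_cmult_indicator)
    also have "\<dots> \<le> (\<Sum>k. ennreal (2 powr n * A * \<rho> powr \<alpha> * q ^ k))"
    proof (intro suminf_le)
      fix k
      have "ennreal (b k) * emeasure \<mu> (ball x (\<rho> / 2^k)) \<le> ennreal (b k) * ennreal (A * (\<rho> / 2^k) powr n)"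
        by (intro mult_left_mono growth) (use \<rho> in auto)
      also have "\<dots> = ennreal (b k * (A * (\<rho> / 2^k) powr n))"
        using A_nonneg b0 by (simp add: ennreal_mult)
      also have "b k * (A * (\<rho> / 2^k) powr n) = 2 powr n * A * \<rho> powr \<alpha> * q ^ k"
      proof -
        have 1: "(\<rho> / 2^k) powr \<alpha> = \<rho> powr \<alpha> * q ^ k"
        proof -
          have "(\<rho> / 2^k) powr \<alpha> = (\<rho> * (1/2)^k) powr \<alpha>" by (simp add: power_divide)
          also have "\<dots> = \<rho> powr \<alpha> * ((1/2)^k) powr \<alpha>" using \<rho> by (simp add: powr_mult)
          also have "((1/2)^k) powr \<alpha> = q ^ k" unfolding q_def
            by (rule power_powr_commute) simp
          finally show ?thesis .
        qed
        have "\<rho> / 2^(k+1) = (\<rho> / 2^k) * (1/2)" by simp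
        then have "(\<rho> / 2^(k+1)) powr (-n) = (\<rho> / 2^k) powr (-n) * (1/2) powr (-n)"
          using \<rho> by (metis powr_mult)
        also have "(1/2::real) powr (-n) = 2 powr n" by (simp add: powr_minus powr_divide)
        finally have 2: "(\<rho> / 2^(k+1)) powr (-n) * (\<rho> / 2^k) powr n = 2 powr n"
          using \<rho> by (simp add: powr_minus)
        have "b k * (A * (\<rho> / 2^k) powr n) = A * (\<rho> / 2^k) powr \<alpha> * ((\<rho> / 2^(k+1)) powr (-n) * (\<rho> / 2^k) powr n)"
          by (simp add: b_def)
        then show ?thesis unfolding 1 2 by (simp only: mult_ac)
      qed
      finally show "ennreal (b k) * emeasure \<mu> (ball x (\<rho> / 2^k)) \<le> ennreal (2 powr n * A * \<rho> powr \<alpha> * q ^ k)" .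
    qed auto
    also have "\<dots> = ennreal (2 powr n * A * \<rho> powr \<alpha> / (1 - q))"
      by (rule suminf_geometric_ennreal) (use q A_nonneg in auto)
    also have "\<dots> = ennreal (C * \<rho> powr \<alpha>)" by (simp add: C_def)
    finally show ?thesis .
  qed
  show ?thesis
  proof (intro exI[of _ C] conjI C allI impI)
    fix x :: 'a and \<rho> :: real assume \<rho>: "0 < \<rho>"
    have *: "(\<lambda>z. indicator (ball x \<rho>) z * dist x z powr (\<alpha> - n)) \<in> borel_measurable \<mu>"
      "\<And>z. 0 \<le> indicator (ball x \<rho>) z * dist x z powr (\<alpha> - n)" "0 \<le> C * \<rho> powr \<alpha>"
      using C by (auto simp: sets_mu)
    show "integrable \<mu> (\<lambda>z. indicator (ball x \<rho>) z * dist x z powr (\<alpha> - n))"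
      "(\<integral>z. indicator (ball x \<rho>) z * dist x z powr (\<alpha> - n) \<partial>\<mu>) \<le> C * \<rho> powr \<alpha>"
      using integrable_from_nn_bound[OF *(1,2) main[OF \<rho>] *(3)] by blast+
  qed
qed

text \<open>The same summation outwards: the shell between the radii \<open>\<rho> * 2^j\<close> and
  \<open>\<rho> * 2^(j+1)\<close> contributes its radius to the power -n - s times a mass of order
  n, and the surplus -s makes the series geometric.\<close>

lemma far_integral:
  assumes s: "0 < s"
  shows "\<exists>C\<ge>0. \<forall>x \<rho>. 0 < \<rho> \<longrightarrow>
     integrable \<mu> (\<lambda>z. indicator (- ball x \<rho>) z * dist x z powr (- n - s)) \<and>
     (\<integral>z. indicator (- ball x \<rho>) z * dist x z powr (- n - s) \<partial>\<mu>) \<le> C * \<rho> powr (- s)"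
proof -
  define q where "q = (1/2::real) powr s"
  have q: "0 \<le> q" "q < 1"
    using s powr_less_mono'[of "1/2::real" 0 s] by (auto simp: q_def)
  define C where "C = 2 powr n * A / (1 - q)"
  have C: "0 \<le> C" using q A_nonneg by (auto simp: C_def)
  have main: "(\<integral>\<^sup>+z. ennreal (indicator (- ball x \<rho>) z * dist x z powr (- n - s)) \<partial>\<mu>) \<le> ennreal (C * \<rho> powr (- s))"
    if \<rho>: "0 < \<rho>" for x \<rho>
  proof -
    define b where "b k = (\<rho> * 2^k) powr (- n - s)" for k :: nat
    have b0: "0 \<le> b k" for k by (simp add: b_def)
    have dom: "ennreal (indicator (- ball x \<rho>) z * dist x z powr (- n - s))
        \<le> (\<Sum>k. ennreal (b k) * indicator (ball x (\<rho> * 2^(k+1))) z)" for z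
    proof (cases "dist x z < \<rho>")
      case False
      define t where "t = dist x z"
      have t: "\<rho> \<le> t" using False by (auto simp: t_def)
      obtain j where k: "2^j \<le> t / \<rho>" "t / \<rho> < 2^(j+1)"
        using dyadic_scale[of "t / \<rho>"] t \<rho> by auto
      have j: "\<rho> * 2^j \<le> t" "t < \<rho> * 2^(j+1)" using k \<rho> by (auto simp: field_simps)
      have "t powr (- n - s) \<le> b j" unfolding b_def
        by (intro powr_mono2') (use j \<rho> s n_pos in auto)
      then have "ennreal (indicator (- ball x \<rho>) z * dist x z powr (- n - s))
          \<le> ennreal (b j) * indicator (ball x (\<rho> * 2^(j+1))) z"
        using j False by (auto simp: t_def ennreal_leI)
      also have "\<dots> \<le> (\<Sum>k. ennreal (b k) * indicator (ball x (\<rho> * 2^(k+1))) z)"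
        by (rule ennreal_le_suminf[where f = "\<lambda>k. ennreal (b k) * indicator (ball x (\<rho> * 2^(k+1))) z"])
      finally show ?thesis .
    qed auto
    have "(\<integral>\<^sup>+z. ennreal (indicator (- ball x \<rho>) z * dist x z powr (- n - s)) \<partial>\<mu>)
        \<le> (\<integral>\<^sup>+z. (\<Sum>k. ennreal (b k) * indicator (ball x (\<rho> * 2^(k+1))) z) \<partial>\<mu>)"
      by (intro nn_integral_mono dom)
    also have "\<dots> = (\<Sum>k. ennreal (b k) * emeasure \<mu> (ball x (\<rho> * 2^(k+1))))"
      by (simp add: nn_integral_suminf nn_integral_cmult_indicator)
    also have "\<dots> \<le> (\<Sum>k. ennreal (2 powr n * A * \<rho> powr (- s) * q ^ k))"
    proof (intro suminf_le)
      fix k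
      have "ennreal (b k) * emeasure \<mu> (ball x (\<rho> * 2^(k+1))) \<le> ennreal (b k) * ennreal (A * (\<rho> * 2^(k+1)) powr n)"
        by (intro mult_left_mono growth) (use \<rho> in auto)
      also have "\<dots> = ennreal (b k * (A * (\<rho> * 2^(k+1)) powr n))"
        using A_nonneg b0 by (simp add: ennreal_mult)
      also have "b k * (A * (\<rho> * 2^(k+1)) powr n) = 2 powr n * A * \<rho> powr (- s) * q ^ k"
      proof -
        have 1: "(\<rho> * 2^k) powr (- s) = \<rho> powr (- s) * q ^ k"
        proof -
          have "(\<rho> * 2^k) powr (- s) = \<rho> powr (- s) * (2^k) powr (- s)" using \<rho> by (simp add: powr_mult)
          also have "(2^k) powr (- s) = q ^ k" unfolding q_def
            by (subst power_powr_commute) (simp_all add: powr_divide powr_minus_divide)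
          finally show ?thesis .
        qed
        have "\<rho> * 2^(k+1) = (\<rho> * 2^k) * 2" by simp
        then have 3: "(\<rho> * 2^(k+1)) powr n = (\<rho> * 2^k) powr n * 2 powr n"
          using \<rho> by (metis powr_mult)
        have 2: "b k = (\<rho> * 2^k) powr (- s) * (\<rho> * 2^k) powr (- n)"
          unfolding b_def by (subst powr_add[symmetric]) (simp add: algebra_simps)
        have 4: "(\<rho> * 2^k) powr (- n) * (\<rho> * 2^k) powr n = 1"
          using \<rho> by (simp add: powr_minus)
        have "b k * (A * (\<rho> * 2^(k+1)) powr n) = (\<rho> * 2^k) powr (- s) * A * 2 powr n * ((\<rho> * 2^k) powr (- n) * (\<rho> * 2^k) powr n)"
          unfolding 2 3 by (simp only: mult_ac)
        then show ?thesis unfolding 1 4 by (simp only: mult_ac mult_1_right)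
      qed
      finally show "ennreal (b k) * emeasure \<mu> (ball x (\<rho> * 2^(k+1))) \<le> ennreal (2 powr n * A * \<rho> powr (- s) * q ^ k)" .
    qed auto
    also have "\<dots> = ennreal (2 powr n * A * \<rho> powr (- s) / (1 - q))"
      by (rule suminf_geometric_ennreal) (use q A_nonneg in auto)
    also have "\<dots> = ennreal (C * \<rho> powr (- s))" by (simp add: C_def)
    finally show ?thesis .
  qed
  show ?thesis
  proof (intro exI[of _ C] conjI C allI impI)
    fix x :: 'a and \<rho> :: real assume \<rho>: "0 < \<rho>"
    have *: "(\<lambda>z. indicator (- ball x \<rho>) z * dist x z powr (- n - s)) \<in> borel_measurable \<mu>"
      "\<And>z. 0 \<le> indicator (- ball x \<rho>) z * dist x z powr (- n - s)" "0 \<le> C * \<rho> powr (- s)"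
      using C by (auto simp: sets_mu)
    show "integrable \<mu> (\<lambda>z. indicator (- ball x \<rho>) z * dist x z powr (- n - s))"
      "(\<integral>z. indicator (- ball x \<rho>) z * dist x z powr (- n - s) \<partial>\<mu>) \<le> C * \<rho> powr (- s)"
      using integrable_from_nn_bound[OF *(1,2) main[OF \<rho>] *(3)] by blast+
  qed
qed

text \<open>Naming the constants makes visible that the later bounds share them for all centres,
  radii and functions.\<close>

definition near_const :: "real \<Rightarrow> real" where
  "near_const \<alpha> = (SOME C. 0 \<le> C \<and> (\<forall>x \<rho>. 0 < \<rho> \<longrightarrow>
     integrable \<mu> (\<lambda>z. indicator (ball x \<rho>) z * dist x z powr (\<alpha> - n)) \<and>
     (\<integral>z. indicator (ball x \<rho>) z * dist x z powr (\<alpha> - n) \<partial>\<mu>) \<le> C * \<rho> powr \<alpha>))"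

definition far_const :: "real \<Rightarrow> real" where
  "far_const s = (SOME C. 0 \<le> C \<and> (\<forall>x \<rho>. 0 < \<rho> \<longrightarrow>
     integrable \<mu> (\<lambda>z. indicator (- ball x \<rho>) z * dist x z powr (- n - s)) \<and>
     (\<integral>z. indicator (- ball x \<rho>) z * dist x z powr (- n - s) \<partial>\<mu>) \<le> C * \<rho> powr (- s)))"

lemma near_const:
  assumes "0 < \<alpha>"
  shows "0 \<le> near_const \<alpha>"
    and "0 < \<rho> \<Longrightarrow> integrable \<mu> (\<lambda>z. indicator (ball x \<rho>) z * dist x z powr (\<alpha> - n))"
    and "0 < \<rho> \<Longrightarrow> (\<integral>z. indicator (ball x \<rho>) z * dist x z powr (\<alpha> - n) \<partial>\<mu>) \<le> near_const \<alpha> * \<rho> powr \<alpha>"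
  using someI_ex[OF near_integral[OF assms], folded near_const_def] by blast+

lemma far_const:
  assumes "0 < s"
  shows "0 \<le> far_const s"
    and "0 < \<rho> \<Longrightarrow> integrable \<mu> (\<lambda>z. indicator (- ball x \<rho>) z * dist x z powr (- n - s))"
    and "0 < \<rho> \<Longrightarrow> (\<integral>z. indicator (- ball x \<rho>) z * dist x z powr (- n - s) \<partial>\<mu>) \<le> far_const s * \<rho> powr (- s)"
  using someI_ex[OF far_integral[OF assms], folded far_const_def] by blast+

text \<open>The spheres about \<open>p\<close> are disjoint, so a finite measure charges only
  countably many of them. They appear here as the atoms of the image, under the distance from
  \<open>p\<close>, of \<mu> restricted to a ball.\<close>

lemma null_sphere:
  assumes "0 < \<delta>"
  shows "\<exists>r. \<delta> < r \<and> r < 2 * \<delta> \<and> sphere p r \<in> null_sets \<mu>"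
proof -
  define M where "M = distr (density \<mu> (indicator (ball p (2*\<delta>)))) borel (dist p)"
  have [measurable]: "dist p \<in> borel_measurable \<mu>" by measurable
  have [measurable]: "ball p (2*\<delta>) \<in> sets \<mu>" "sphere p r \<in> sets \<mu>" for r by (auto simp: sets_mu)
  have ib [measurable]: "(indicator (ball p (2*\<delta>)) :: 'a \<Rightarrow> ennreal) \<in> borel_measurable \<mu>" by measurable
  have em: "emeasure M {r} = emeasure \<mu> (ball p (2*\<delta>) \<inter> sphere p r)" for r
  proof -
    have "emeasure M {r} = emeasure (density \<mu> (indicator (ball p (2*\<delta>)))) (sphere p r)"
      unfolding M_def by (subst emeasure_distr) (auto intro!: arg_cong[where f="emeasure _"])
    also have "\<dots> = (\<integral>\<^sup>+x. indicator (ball p (2*\<delta>)) x * indicator (sphere p r) x \<partial>\<mu>)"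
      by (rule emeasure_density) auto
    also have "\<dots> = (\<integral>\<^sup>+x. indicator (ball p (2*\<delta>) \<inter> sphere p r) x \<partial>\<mu>)"
      by (intro nn_integral_cong) (auto split: split_indicator)
    also have "\<dots> = emeasure \<mu> (ball p (2*\<delta>) \<inter> sphere p r)"
      by (rule nn_integral_indicator) (auto simp: sets_mu)
    finally show ?thesis .
  qed
  interpret M: finite_measure M
  proof
    have "emeasure M (space M) = emeasure \<mu> (ball p (2*\<delta>))"
      unfolding M_def by (subst emeasure_distr, simp, simp, subst emeasure_density) (auto simp: nn_integral_indicator)
    then show "emeasure M (space M) \<noteq> \<infinity>" using finite_ball[of p "2*\<delta>"] by simp
  qed
  have "uncountable {\<delta><..<2*\<delta>}" using assms uncountable_open_interval by simp
  then have "\<not> {\<delta><..<2*\<delta>} \<subseteq> {r. measure M {r} \<noteq> 0}"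
    using M.countable_support countable_subset by blast
  then obtain r where r: "\<delta> < r" "r < 2*\<delta>" "measure M {r} = 0" by auto
  then have "emeasure M {r} = 0" by (simp add: M.emeasure_eq_measure)
  moreover have "ball p (2*\<delta>) \<inter> sphere p r = sphere p r" using r by auto
  ultimately show ?thesis using r em by (auto simp: null_sets_def sets_mu)
qed

text \<open>A finite cover by balls with null spheres is made disjoint, which creates no boundary
  outside these spheres. The last property makes a function that vanishes a.e. off
  \<open>closure (P i)\<close> vanish a.e. off \<open>P i\<close>.\<close>

lemma small_partition:
  assumes \<delta>: "0 < \<delta>" and "bounded E" and "E \<noteq> {}"
  obtains P :: "nat \<Rightarrow> 'a set" and m :: nat where
    "\<And>i. P i \<in> sets borel" "disjoint_family P" "E \<subseteq> (\<Union>i<m. P i)"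
    "\<And>i. \<exists>q\<in>closure E. P i \<subseteq> ball q \<delta>"
    "\<And>i. AE x in \<mu>. x \<notin> P i \<longrightarrow> x \<notin> closure (P i)"
proof -
  have "\<forall>q. \<exists>r. \<delta>/2 < r \<and> r < \<delta> \<and> sphere q r \<in> null_sets \<mu>"
    using null_sphere[of "\<delta>/2"] \<delta> by auto
  then obtain \<rho> where \<rho>: "\<And>q. \<delta>/2 < \<rho> q" "\<And>q. \<rho> q < \<delta>" "\<And>q. sphere q (\<rho> q) \<in> null_sets \<mu>" by metis
  have comp: "compact (closure E)" using assms by (simp add: compact_closure)
  have "closure E \<subseteq> (\<Union>q\<in>closure E. ball q (\<rho> q))" using \<rho>(1) \<delta> by (force intro: less_trans[of 0 "\<delta>/2"])
  then obtain F where F: "F \<subseteq> closure E" "finite F" "closure E \<subseteq> (\<Union>q\<in>F. ball q (\<rho> q))"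
    using compactE_image[OF comp, of "closure E" "\<lambda>q. ball q (\<rho> q)"] by auto
  have "F \<noteq> {}" using F(3) \<open>E \<noteq> {}\<close> closure_subset by blast
  then obtain m and e :: "nat \<Rightarrow> 'a" where e: "F = e ` {..<m}" "m \<noteq> 0"
    using finite_imp_nat_seg_image_inj_on[OF F(2)] by (metis image_is_empty lessThan_def lessThan_empty_iff)
  \<comment> \<open>From \<open>m\<close> on a centre is repeated, so every index has its centre in
    \<open>F\<close> and the additional disjointed pieces are empty.\<close>
  define c where "c i = e (if i < m then i else 0)" for i
  have cF: "c i \<in> F" for i using e by (auto simp: c_def)
  define P where "P = disjointed (\<lambda>i. ball (c i) (\<rho> (c i)))"
  have PS: "P i \<in> sets borel" for i
    unfolding P_def disjointed_def by auto
  have sub: "P i \<subseteq> ball (c i) (\<rho> (c i))" for i by (auto simp: P_def disjointed_def)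
  show ?thesis
  proof (rule that[of P m])
    show "P i \<in> sets borel" for i by (rule PS)
    show "disjoint_family P" unfolding P_def by (rule disjoint_family_disjointed)
    have "(\<Union>i<m. P i) = (\<Union>i<m. ball (c i) (\<rho> (c i)))"
      unfolding P_def using finite_UN_disjointed_eq[of "\<lambda>i. ball (c i) (\<rho> (c i))" m]
      by (simp add: atLeast0LessThan)
    also have "\<dots> = (\<Union>q\<in>F. ball q (\<rho> q))" unfolding e by (auto simp: c_def)
    finally show "E \<subseteq> (\<Union>i<m. P i)" using F(3) closure_subset[of E] by (metis order_trans)
    show "\<exists>q\<in>closure E. P i \<subseteq> ball q \<delta>" for i
    proof
      show "c i \<in> closure E" using cF F by blast
      show "P i \<subseteq> ball (c i) \<delta>" using sub[of i] \<rho>(2)[of "c i"] by auto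
    qed
    fix i
    have "AE x in \<mu>. x \<notin> sphere (c j) (\<rho> (c j))" for j
      by (rule AE_not_in) (rule \<rho>(3))
    then have "AE x in \<mu>. \<forall>j. x \<notin> sphere (c j) (\<rho> (c j))" by (simp only: AE_all_countable) blast
    then show "AE x in \<mu>. x \<notin> P i \<longrightarrow> x \<notin> closure (P i)"
    proof (rule eventually_mono, intro impI)
      fix x assume nb: "\<forall>j. x \<notin> sphere (c j) (\<rho> (c j))" and "x \<notin> P i"
      \<comment> \<open>A point outside its own ball and off the sphere is off the closed ball; a
        point of an earlier ball has an open neighbourhood that misses \<open>P i\<close>.\<close>
      then consider "x \<notin> ball (c i) (\<rho> (c i))" | j where "j < i" "x \<in> ball (c j) (\<rho> (c j))"
        by (auto simp: P_def disjointed_def)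
      then show "x \<notin> closure (P i)"
      proof cases
        case 1
        then have "x \<notin> cball (c i) (\<rho> (c i))" using nb[rule_format, of i] by auto
        moreover have "closure (P i) \<subseteq> cball (c i) (\<rho> (c i))"
          by (rule closure_minimal) (use sub[of i] in auto)
        ultimately show ?thesis by blast
      next
        case 2
        have "P i \<inter> ball (c j) (\<rho> (c j)) = {}" using 2 by (auto simp: P_def disjointed_def)
        then have "closure (P i) \<inter> ball (c j) (\<rho> (c j)) = {}"
          by (metis open_ball open_Int_closure_eq_empty inf_commute)
        then show ?thesis using 2 by blast
      qed
    qed
  qed
qed

end

text \<open>Here \<open>m j\<close> will be the density of the ball of radius \<open>2\<^sup>j r\<close> and \<open>c j\<close> the size of its constant
  \<open>c\<^sub>B\<close>.\<close>

lemma doubling_sequence: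
  fixes m :: "nat \<Rightarrow> real" and c :: "nat \<Rightarrow> real"
  assumes pos: "0 < m 0" and nn: "\<And>k. 0 \<le> m k" and ub: "\<And>k. m k \<le> C" and "0 \<le> A" and "0 \<le> D"
    and step: "\<And>k. c k \<le> c (k+1) + A * m (k+2)"
    and dbl: "\<And>k. m (k+1) \<le> 2 * m k \<Longrightarrow> c k \<le> D"
  shows "c 0 \<le> D + 3 * A * C"
proof -
  \<comment> \<open>Otherwise the densities would double for ever, against their upper bound
    \<open>C\<close>.\<close>
  have "\<exists>K. m (K+1) \<le> 2 * m K"
  proof (rule ccontr)
    assume "\<not> ?thesis"
    then have g: "m (k+1) > 2 * m k" for k by (auto simp: not_le)
    have "2^k * m 0 \<le> m k" for k
    proof (induction k)
      case (Suc k) then show ?case using g[of k] by simp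
    qed simp
    then have "2^k * m 0 \<le> C" for k using ub order_trans by blast
    then have "2^k \<le> C / m 0" for k using pos by (simp add: field_simps)
    then show False using real_arch_pow[of 2 "C / m 0"] by (force simp: not_le[symmetric])
  qed
  then obtain K where K: "m (K+1) \<le> 2 * m K" by blast
  have C0: "0 \<le> C" using nn[of 0] ub[of 0] by linarith
  have bd: "D \<le> D + A * C + 2 * A * (C - m j)" "A * m j \<le> A * C" "0 \<le> A * m j" for j
    using ub[of j] nn[of j] C0 \<open>0 \<le> A\<close> by (auto intro!: add_nonneg_nonneg mult_left_mono)
  \<comment> \<open>\<open>C - m (k+1)\<close> acts as a potential for a downward induction. If
    \<open>m (k+2) > 2 * m (k+1)\<close>, then the increment \<open>A * m (k+2)\<close> is at most
    \<open>2 * A * (m (k+2) - m (k+1))\<close>, which telescopes. The extra \<open>A * C\<close>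
    pays for the one step that lands on a doubling index, where this estimate fails but
    \<open>c (k+1) \<le> D\<close>.\<close>
  have "c k \<le> D + A * C + 2 * A * (C - m (k+1))" if "k \<le> K" for k
    using that
  proof (induction rule: inc_induct)
    case base then show ?case using dbl[OF K] bd(1)[of "K+1"] by linarith
  next
    case (step k)
    show ?case
    proof (cases "m (k+1) \<le> 2 * m k")
      case True then show ?thesis using dbl[OF True] bd(1)[of "k+1"] by linarith
    next
      case nd: False
      show ?thesis
      proof (cases "m (k+2) \<le> 2 * m (k+1)")
        case True
        then have "c (k+1) \<le> D" using dbl[of "k+1"] by simp
        moreover have "0 \<le> 2 * A * (C - m (k+1))" using ub[of "k+1"] \<open>0 \<le> A\<close> by simp
        ultimately show ?thesis using assms(6)[of k] bd(2)[of "k+2"] by linarith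
      next
        case False
        have "A * (2 * m (k+1)) \<le> A * m (k+2)" using False \<open>0 \<le> A\<close> by (intro mult_left_mono) auto
        moreover have "c (k+1) \<le> D + A * C + 2 * A * (C - m (k+2))" using step.IH by simp
        ultimately show ?thesis using assms(6)[of k] by (simp add: algebra_simps)
      qed
    qed
  qed
  from this[of 0] show ?thesis using bd(3)[of 1] by (simp add: algebra_simps)
qed

lemma powr_add_le:
  fixes a b \<alpha> :: real
  assumes "0 \<le> a" "0 \<le> b" "0 \<le> \<alpha>"
  shows "(a + b) powr \<alpha> \<le> 2 powr \<alpha> * (a powr \<alpha> + b powr \<alpha>)"
proof -
  have "(a + b) powr \<alpha> \<le> (2 * max a b) powr \<alpha>" by (rule powr_mono2) (use assms in auto)
  also have "\<dots> = 2 powr \<alpha> * max a b powr \<alpha>" using assms by (simp add: powr_mult)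
  also have "\<dots> \<le> 2 powr \<alpha> * (a powr \<alpha> + b powr \<alpha>)"
    by (intro mult_left_mono) (auto simp: max_def)
  finally show ?thesis .
qed

abbreviation cut :: "'a set \<Rightarrow> ('a \<Rightarrow> 'b::real_vector) \<Rightarrow> 'a \<Rightarrow> 'b" where
  "cut E f \<equiv> (\<lambda>z. indicator E z *\<^sub>R f z)"

lemma borel_Diff_ball:
  fixes p q :: "'a::euclidean_space"
  shows "ball p r - ball q s \<in> sets borel" "bounded (ball p r - ball q s)"
  by auto

lemma Int_Diff_ball: "(B - C) \<inter> C = {}"
  by auto

section \<open>Functions of at most power growth\<close>

context growth_measure begin

text \<open>The functions for which all the kernel integrals at infinity converge.\<close>

definition grows :: "real \<Rightarrow> ('a \<Rightarrow> 'b::real_normed_vector) \<Rightarrow> bool" where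
  "grows \<alpha> h \<longleftrightarrow> h \<in> borel_measurable \<mu> \<and> (\<exists>B\<ge>0. AE z in \<mu>. norm (h z) \<le> B * (1 + dist 0 z powr \<alpha>))"

lemma weight_change_center:
  assumes "0 \<le> \<alpha>"
  shows "1 + dist p z powr \<alpha> \<le> (1 + 2 powr \<alpha> * (1 + dist p q powr \<alpha>)) * (1 + dist q z powr \<alpha>)"
proof -
  have "dist p z powr \<alpha> \<le> (dist p q + dist q z) powr \<alpha>"
    by (rule powr_mono2) (use assms dist_triangle[of p z q] in auto)
  also have "\<dots> \<le> 2 powr \<alpha> * (dist p q powr \<alpha> + dist q z powr \<alpha>)"
    by (rule powr_add_le) (use assms in auto)
  also have "\<dots> \<le> 2 powr \<alpha> * ((1 + dist p q powr \<alpha>) * (1 + dist q z powr \<alpha>))"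
    by (intro mult_left_mono) (auto simp: algebra_simps)
  finally have "1 + dist p z powr \<alpha>
      \<le> (1 + dist q z powr \<alpha>) + 2 powr \<alpha> * (1 + dist p q powr \<alpha>) * (1 + dist q z powr \<alpha>)"
    unfolding mult.assoc by (intro add_mono) auto
  then show ?thesis by (simp only: distrib_right mult_1)
qed

lemma weight_bound_change_center:
  assumes "0 \<le> \<alpha>" "0 \<le> B" "AE z in \<mu>. norm (h z) \<le> B * (1 + dist p z powr \<alpha>)"
  shows "\<exists>B'\<ge>0. AE z in \<mu>. norm (h z) \<le> B' * (1 + dist q z powr \<alpha>)"
proof (intro exI conjI)
  define B' where "B' = B * (1 + 2 powr \<alpha> * (1 + dist p q powr \<alpha>))"
  show "0 \<le> B'" using assms by (auto simp: B'_def intro!: mult_nonneg_nonneg add_nonneg_nonneg)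
  have "B * (1 + dist p z powr \<alpha>) \<le> B' * (1 + dist q z powr \<alpha>)" for z
    unfolding B'_def mult.assoc
    by (rule mult_left_mono[OF weight_change_center[OF assms(1)] assms(2)])
  then show "AE z in \<mu>. norm (h z) \<le> B' * (1 + dist q z powr \<alpha>)"
    using assms(3) by (auto elim!: eventually_mono intro: order_trans)
qed

lemma growsI:
  assumes "h \<in> borel_measurable \<mu>" "0 \<le> \<alpha>" "0 \<le> B" "AE z in \<mu>. norm (h z) \<le> B * (1 + dist p z powr \<alpha>)"
  shows "grows \<alpha> h"
  unfolding grows_def using assms(1) weight_bound_change_center[OF assms(2-4)] by blast

lemma grows_at:
  assumes "grows \<alpha> h" "0 \<le> \<alpha>"
  shows "\<exists>B\<ge>0. AE z in \<mu>. norm (h z) \<le> B * (1 + dist p z powr \<alpha>)"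
  using assms(1) weight_bound_change_center[OF assms(2)] unfolding grows_def by blast

lemma grows_bounded:
  assumes "grows \<alpha> h" "0 \<le> \<alpha>" "bounded E"
  shows "\<exists>b\<ge>0. AE z in \<mu>. z \<in> E \<longrightarrow> norm (h z) \<le> b"
proof -
  obtain B where B: "0 \<le> B" "AE z in \<mu>. norm (h z) \<le> B * (1 + dist 0 z powr \<alpha>)"
    using assms by (auto simp: grows_def)
  obtain R where R: "E \<subseteq> ball 0 R" using bounded_subset_ballD[OF assms(3), of 0] by blast
  show ?thesis
  proof (intro exI[of _ "B * (1 + R powr \<alpha>)"] conjI)
    show "0 \<le> B * (1 + R powr \<alpha>)" using B(1) by (auto intro!: mult_nonneg_nonneg add_nonneg_nonneg)
    show "AE z in \<mu>. z \<in> E \<longrightarrow> norm (h z) \<le> B * (1 + R powr \<alpha>)"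
      using B(2)
    proof (rule eventually_mono, intro impI)
      fix z assume *: "norm (h z) \<le> B * (1 + dist 0 z powr \<alpha>)" "z \<in> E"
      have "dist 0 z powr \<alpha> \<le> R powr \<alpha>" by (rule powr_mono2) (use * R assms in auto)
      then have "B * (1 + dist 0 z powr \<alpha>) \<le> B * (1 + R powr \<alpha>)" using B(1) by (intro mult_left_mono) auto
      then show "norm (h z) \<le> B * (1 + R powr \<alpha>)" using * by linarith
    qed
  qed
qed

lemma grows_const: "0 \<le> \<alpha> \<Longrightarrow> grows \<alpha> (\<lambda>_. c)"
  by (rule growsI[of _ _ "norm c" 0]) (auto simp: algebra_simps)

text \<open>Away from \<open>p\<close> the summand 1 of the weight is absorbed by the power of the
  distance, the form that pairs with the decay of kernel differences.\<close>

lemma grows_outside: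
  assumes "grows \<alpha> h" "0 \<le> \<alpha>" "0 < r"
  shows "\<exists>B\<ge>0. AE z in \<mu>. z \<notin> ball p r \<longrightarrow> norm (h z) \<le> B * dist p z powr \<alpha>"
proof -
  obtain B where B: "0 \<le> B" "AE z in \<mu>. norm (h z) \<le> B * (1 + dist p z powr \<alpha>)"
    using grows_at[OF assms(1,2), of p] by blast
  show ?thesis
  proof (intro exI[of _ "B * (r powr (-\<alpha>) + 1)"] conjI)
    show "0 \<le> B * (r powr (-\<alpha>) + 1)" using B(1) by (auto intro!: mult_nonneg_nonneg add_nonneg_nonneg)
    show "AE z in \<mu>. z \<notin> ball p r \<longrightarrow> norm (h z) \<le> B * (r powr (-\<alpha>) + 1) * dist p z powr \<alpha>"
      using B(2)
    proof (rule eventually_mono, intro impI)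
      fix z assume *: "norm (h z) \<le> B * (1 + dist p z powr \<alpha>)" "z \<notin> ball p r"
      have "r powr \<alpha> \<le> dist p z powr \<alpha>" by (rule powr_mono2) (use * assms in auto)
      then have "r powr (-\<alpha>) * r powr \<alpha> \<le> r powr (-\<alpha>) * dist p z powr \<alpha>" by (rule mult_left_mono) auto
      then have "1 \<le> r powr (-\<alpha>) * dist p z powr \<alpha>" using assms by (simp add: powr_minus)
      then have "B * (1 + dist p z powr \<alpha>) \<le> B * ((r powr (-\<alpha>) + 1) * dist p z powr \<alpha>)"
        using B(1) by (intro mult_left_mono) (auto simp: algebra_simps)
      then show "norm (h z) \<le> B * (r powr (-\<alpha>) + 1) * dist p z powr \<alpha>" using * by (simp add: mult.assoc)
    qed
  qed
qed

text \<open>The Lipschitz condition of a class holds only off a null set; \<open>G\<close> is a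
  conull set on which it holds for every pair, so that one point of \<open>G\<close> can serve as a
  reference.\<close>

lemma lip_grows:
  assumes f: "f \<in> borel_measurable \<mu>" and G: "AE x in \<mu>. x \<in> G" and "0 \<le> L" "0 \<le> \<alpha>"
    and lip: "\<And>x y. x \<in> G \<Longrightarrow> y \<in> G \<Longrightarrow> norm (f x - f y) \<le> L * dist x y powr \<alpha>"
  shows "grows \<alpha> f"
proof (cases "G = {}")
  case True
  then have "AE x in \<mu>. False" using G by simp
  then show ?thesis by (intro growsI[OF f, of \<alpha> 0 0]) (use assms in \<open>auto elim: eventually_mono\<close>)
next
  case False
  then obtain x where x: "x \<in> G" by auto
  show ?thesis
  proof (rule growsI[OF f, of \<alpha> "L + norm (f x)" x])
    show "AE z in \<mu>. norm (f z) \<le> (L + norm (f x)) * (1 + dist x z powr \<alpha>)"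
      using G
    proof (rule eventually_mono)
      fix z assume "z \<in> G"
      then have "norm (f z - f x) \<le> L * dist x z powr \<alpha>" using lip x by (metis dist_commute)
      then have "norm (f z) \<le> L * dist x z powr \<alpha> + norm (f x)"
        using norm_triangle_ineq[of "f z - f x" "f x"] by simp
      also have "\<dots> \<le> (L + norm (f x)) * (1 + dist x z powr \<alpha>)"
        using assms(3) by (simp add: algebra_simps)
      finally show "norm (f z) \<le> (L + norm (f x)) * (1 + dist x z powr \<alpha>)" .
    qed
  qed (use assms in auto)
qed

text \<open>Balls about support points have positive measure. This turns an a.e. identity between
  constants on such a ball into an identity.\<close>

lemma AE_ball_obtain:
  assumes "p \<in> msupport \<mu>" "0 < r" "AE x in \<mu>. x \<in> ball p r \<longrightarrow> Q x"
  obtains x where "x \<in> ball p r" "Q x"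
proof -
  have "\<exists>x. x \<in> ball p r \<and> Q x"
  proof (rule ccontr)
    assume "\<not> ?thesis"
    then have "AE x in \<mu>. x \<notin> ball p r" using assms(3) by (auto elim: eventually_mono)
    then have "emeasure \<mu> (ball p r) = 0" by (subst (asm) AE_iff_measurable[of "ball p r"]) auto
    then show False using assms(1,2) by (force simp: msupport_def)
  qed
  then show ?thesis using that by blast
qed

lemma L2_cut:
  fixes f :: "'a \<Rightarrow> 'k::{real_normed_field, banach, second_countable_topology}"
  assumes f: "f \<in> borel_measurable \<mu>" and E: "E \<in> sets borel" "bounded E"
    and b: "0 \<le> b" "AE z in \<mu>. z \<in> E \<longrightarrow> norm (f z) \<le> b"
  shows "cut E f \<in> L2 \<mu>" "(\<integral>z. (norm (cut E f z))\<^sup>2 \<partial>\<mu>) \<le> b\<^sup>2 * measure \<mu> E"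
proof -
  have [measurable]: "E \<in> sets \<mu>" "f \<in> borel_measurable \<mu>" using E f by (auto simp: sets_mu)
  have i: "integrable \<mu> (\<lambda>z. b\<^sup>2 * indicator E z)"
    using integrable_indicator_bounded[OF E] by simp
  have m: "(\<lambda>z. (norm (cut E f z))\<^sup>2) \<in> borel_measurable \<mu>" by measurable
  have le: "AE z in \<mu>. norm ((norm (cut E f z))\<^sup>2) \<le> b\<^sup>2 * indicator E z"
    using b(2) by (rule eventually_mono) (auto split: split_indicator intro!: power_mono)
  show "cut E f \<in> L2 \<mu>" unfolding L2_def using integrable_dominated(1)[OF i m le] by auto
  have "(\<integral>z. (norm (cut E f z))\<^sup>2 \<partial>\<mu>) \<le> norm (\<integral>z. (norm (cut E f z))\<^sup>2 \<partial>\<mu>)" by simp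
  also have "\<dots> \<le> (\<integral>z. b\<^sup>2 * indicator E z \<partial>\<mu>)" by (rule integrable_dominated(2)[OF i m le])
  also have "\<dots> = b\<^sup>2 * measure \<mu> E" by simp
  finally show "(\<integral>z. (norm (cut E f z))\<^sup>2 \<partial>\<mu>) \<le> b\<^sup>2 * measure \<mu> E" .
qed

end

subsection \<open>Kernel integrals\<close>

text \<open>The kernel is set to \<open>0\<close> on the diagonal, where its values never matter, to be measurable on
  the whole product.\<close>

locale cz_setup = growth_measure \<mu> n A for \<mu> :: "'a::euclidean_space measure" and n A +
  fixes k :: "'a \<Rightarrow> 'a \<Rightarrow> 'k::{real_normed_field, banach, second_countable_topology}"
    and T :: "('a \<Rightarrow> 'k) \<Rightarrow> 'a \<Rightarrow> 'k" and \<epsilon> M N :: real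
  assumes eps_pos: "0 < \<epsilon>"
    and k_measurable: "(\<lambda>(x, y). k x y) \<in> borel_measurable (\<mu> \<Otimes>\<^sub>M \<mu>)"
    and k_diag: "\<And>x. k x x = 0"
    and M_pos: "0 < M"
    and k_size: "\<And>x y. x \<noteq> y \<Longrightarrow> norm (k x y) \<le> M * dist x y powr (- n)"
    and k_reg: "\<And>x x' y. x \<noteq> y \<Longrightarrow> 2 * dist x x' \<le> dist x y \<Longrightarrow>
        norm (k x y - k x' y) \<le> M * dist x x' powr \<epsilon> * dist x y powr (- n - \<epsilon>)"
    and N_pos: "0 < N"
    and T_L2: "\<And>f. f \<in> L2 \<mu> \<Longrightarrow> T f \<in> L2 \<mu>"
    and T_add: "\<And>f g. f \<in> L2 \<mu> \<Longrightarrow> g \<in> L2 \<mu> \<Longrightarrow> AE x in \<mu>. T (\<lambda>y. f y + g y) x = T f x + T g x"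
    and T_cmult: "\<And>f c. f \<in> L2 \<mu> \<Longrightarrow> AE x in \<mu>. T (\<lambda>y. c * f y) x = c * T f x"
    and T_bound: "\<And>f. f \<in> L2 \<mu> \<Longrightarrow> (\<integral>x. (norm (T f x))\<^sup>2 \<partial>\<mu>) \<le> N * (\<integral>x. (norm (f x))\<^sup>2 \<partial>\<mu>)"
    and T_rep: "\<And>f. f \<in> L2 \<mu> \<Longrightarrow> compact (fsupport f) \<Longrightarrow>
        AE x in \<mu>. x \<notin> fsupport f \<longrightarrow> T f x = (\<integral>y. k x y * f y \<partial>\<mu>)"
begin

lemma k_measurable' [measurable (raw)]: "f \<in> measurable X \<mu> \<Longrightarrow> g \<in> measurable X \<mu> \<Longrightarrow> (\<lambda>w. k (f w) (g w)) \<in> borel_measurable X"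
  using measurable_compose[OF measurable_Pair k_measurable, of f X g] by simp

lemma k_section [measurable]: "k x \<in> borel_measurable \<mu>"
  using measurable_compose[OF measurable_Pair1' k_measurable, of x] by simp

lemma T_measurable [measurable]: "f \<in> L2 \<mu> \<Longrightarrow> T f \<in> borel_measurable \<mu>"
  using T_L2[of f] by (simp add: L2_def)

lemma T_sq_integrable: "f \<in> L2 \<mu> \<Longrightarrow> integrable \<mu> (\<lambda>x. (norm (T f x))\<^sup>2)"
  using T_L2[of f] by (simp add: L2_def)

lemma T_rep_cut:
  assumes "cut E f \<in> L2 \<mu>" "bounded E"
  shows "AE x in \<mu>. x \<notin> closure E \<longrightarrow> T (cut E f) x = (\<integral>z. indicator E z *\<^sub>R (k x z * f z) \<partial>\<mu>)"
proof -
  have sub: "fsupport (cut E f) \<subseteq> closure E"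
    unfolding fsupport_def by (rule closure_mono) (auto split: split_indicator_asm)
  have "compact (closure E)" using assms by (simp add: compact_closure)
  then have "compact (fsupport (cut E f))"
    using sub by (metis closed_closure compact_Int_closed fsupport_def inf.absorb2)
  from T_rep[OF assms(1) this] show ?thesis
    by (rule eventually_mono) (use sub in auto)
qed

lemma bounded_kernel_integrable:
  assumes h: "h \<in> borel_measurable \<mu>" and E: "E \<in> sets borel" "bounded E"
    and b: "0 \<le> b" "AE z in \<mu>. z \<in> E \<longrightarrow> norm (h z) \<le> b"
    and \<rho>: "0 < \<rho>" "E \<inter> ball x \<rho> = {}"
  shows "integrable \<mu> (\<lambda>z. indicator E z *\<^sub>R (k x z * h z))"
    "norm (\<integral>z. indicator E z *\<^sub>R (k x z * h z) \<partial>\<mu>) \<le> M * \<rho> powr (- n) * b * measure \<mu> E"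
proof -
  have [measurable]: "E \<in> sets \<mu>" "h \<in> borel_measurable \<mu>" using E h by (auto simp: sets_mu)
  have i: "integrable \<mu> (\<lambda>z. M * \<rho> powr (- n) * b * indicator E z)"
    using integrable_indicator_bounded[OF E] by simp
  have m: "(\<lambda>z. indicator E z *\<^sub>R (k x z * h z)) \<in> borel_measurable \<mu>" by measurable
  have kb: "norm (k x z) \<le> M * \<rho> powr (- n)" if "z \<in> E" for z
  proof -
    have d: "\<rho> \<le> dist x z" using that \<rho> by auto
    then have "norm (k x z) \<le> M * dist x z powr (- n)" using \<rho> by (intro k_size) auto
    also have "\<dots> \<le> M * \<rho> powr (- n)"
      by (intro mult_left_mono powr_mono2') (use d \<rho> M_pos n_pos in auto)
    finally show ?thesis .
  qed
  have le: "AE z in \<mu>. norm (indicator E z *\<^sub>R (k x z * h z)) \<le> M * \<rho> powr (- n) * b * indicator E z"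
    using b(2)
  proof (rule eventually_mono)
    fix z assume "z \<in> E \<longrightarrow> norm (h z) \<le> b"
    then show "norm (indicator E z *\<^sub>R (k x z * h z)) \<le> M * \<rho> powr (- n) * b * indicator E z"
      using kb[of z] M_pos by (cases "z \<in> E") (auto simp: norm_mult intro!: mult_mono)
  qed
  show "integrable \<mu> (\<lambda>z. indicator E z *\<^sub>R (k x z * h z))" by (rule integrable_dominated(1)[OF i m le])
  have "norm (\<integral>z. indicator E z *\<^sub>R (k x z * h z) \<partial>\<mu>) \<le> (\<integral>z. M * \<rho> powr (- n) * b * indicator E z \<partial>\<mu>)"
    by (rule integrable_dominated(2)[OF i m le])
  then show "norm (\<integral>z. indicator E z *\<^sub>R (k x z * h z) \<partial>\<mu>) \<le> M * \<rho> powr (- n) * b * measure \<mu> E" by simp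
qed

text \<open>Vanishing of \<open>h\<close> to order \<alpha> at \<open>x\<close> weakens the
  singularity to the power \<alpha> - n of the distance, which is integrable. At
  \<open>z = x\<close> the convention \<open>k_diag\<close> applies.\<close>

lemma near_kernel_integrable:
  assumes h: "h \<in> borel_measurable \<mu>" and E: "E \<in> sets borel" "E \<subseteq> ball x \<rho>" and "0 < \<rho>" "0 < \<alpha>"
    and B: "0 \<le> B" "AE z in \<mu>. norm (h z) \<le> B * dist x z powr \<alpha>"
  shows "integrable \<mu> (\<lambda>z. indicator E z *\<^sub>R (k x z * h z))"
    "norm (\<integral>z. indicator E z *\<^sub>R (k x z * h z) \<partial>\<mu>) \<le> M * B * near_const \<alpha> * \<rho> powr \<alpha>"
proof -
  have [measurable]: "E \<in> sets \<mu>" "h \<in> borel_measurable \<mu>" using E h by (auto simp: sets_mu)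
  define u where "u z = M * B * (indicator (ball x \<rho>) z * dist x z powr (\<alpha> - n))" for z
  have i: "integrable \<mu> u" unfolding u_def
    by (intro integrable_mult_right near_const) (use assms in auto)
  have m: "(\<lambda>z. indicator E z *\<^sub>R (k x z * h z)) \<in> borel_measurable \<mu>" by measurable
  have le: "AE z in \<mu>. norm (indicator E z *\<^sub>R (k x z * h z)) \<le> u z"
    using B(2)
  proof (rule eventually_mono)
    fix z assume hz: "norm (h z) \<le> B * dist x z powr \<alpha>"
    show "norm (indicator E z *\<^sub>R (k x z * h z)) \<le> u z"
    proof (cases "z \<in> E \<and> z \<noteq> x")
      case True
      have "norm (k x z * h z) \<le> (M * dist x z powr (- n)) * (B * dist x z powr \<alpha>)"
        unfolding norm_mult using True hz k_size[of x z] M_pos B(1) by (intro mult_mono) auto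
      also have "\<dots> = M * B * dist x z powr (\<alpha> - n)" using powr_add[of "dist x z" "- n" \<alpha>] by simp
      finally show ?thesis using True E by (auto simp: u_def)
    next
      case False
      then show ?thesis using M_pos B(1) by (auto simp: u_def k_diag)
    qed
  qed
  show "integrable \<mu> (\<lambda>z. indicator E z *\<^sub>R (k x z * h z))" by (rule integrable_dominated(1)[OF i m le])
  have "norm (\<integral>z. indicator E z *\<^sub>R (k x z * h z) \<partial>\<mu>) \<le> (\<integral>z. u z \<partial>\<mu>)"
    by (rule integrable_dominated(2)[OF i m le])
  also have "\<dots> = M * B * (\<integral>z. indicator (ball x \<rho>) z * dist x z powr (\<alpha> - n) \<partial>\<mu>)" unfolding u_def by simp
  also have "\<dots> \<le> M * B * (near_const \<alpha> * \<rho> powr \<alpha>)"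
    by (intro mult_left_mono near_const) (use assms M_pos in auto)
  finally show "norm (\<integral>z. indicator E z *\<^sub>R (k x z * h z) \<partial>\<mu>) \<le> M * B * near_const \<alpha> * \<rho> powr \<alpha>"
    by (simp add: mult.assoc)
qed

text \<open>Regularity in the first variable gains (r/|p - z|)^\<epsilon>, which leaves the
  integrable power -n - (\<epsilon> - \<beta>) of the distance; the powers of r combine to
  r^\<beta>. The constant function has \<beta> = 0, Lipschitz functions have \<beta> =
  \<alpha>.\<close>

lemma far_kernel_integrable:
  assumes h: "h \<in> borel_measurable \<mu>" and "0 < r" "dist p x \<le> r" "\<beta> < \<epsilon>"
    and B: "0 \<le> B" "AE z in \<mu>. z \<notin> ball p (2 * r) \<longrightarrow> norm (h z) \<le> B * dist p z powr \<beta>"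
  shows "integrable \<mu> (\<lambda>z. indicator (- ball p (2 * r)) z *\<^sub>R ((k x z - k p z) * h z))"
    "norm (\<integral>z. indicator (- ball p (2 * r)) z *\<^sub>R ((k x z - k p z) * h z) \<partial>\<mu>)
       \<le> M * B * far_const (\<epsilon> - \<beta>) * r powr \<beta>"
proof -
  have [measurable]: "h \<in> borel_measurable \<mu>" using h by auto
  have fc: "0 \<le> far_const (\<epsilon> - \<beta>)" by (rule far_const) (use assms in auto)
  define u where "u z = M * r powr \<epsilon> * B * (indicator (- ball p (2 * r)) z * dist p z powr (- n - (\<epsilon> - \<beta>)))" for z
  have i: "integrable \<mu> u" unfolding u_def
    by (intro integrable_mult_right far_const) (use assms in auto)
  have m: "(\<lambda>z. indicator (- ball p (2 * r)) z *\<^sub>R ((k x z - k p z) * h z)) \<in> borel_measurable \<mu>" by measurable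
  have le: "AE z in \<mu>. norm (indicator (- ball p (2 * r)) z *\<^sub>R ((k x z - k p z) * h z)) \<le> u z"
    using B(2)
  proof (rule eventually_mono)
    fix z assume hz: "z \<notin> ball p (2 * r) \<longrightarrow> norm (h z) \<le> B * dist p z powr \<beta>"
    show "norm (indicator (- ball p (2 * r)) z *\<^sub>R ((k x z - k p z) * h z)) \<le> u z"
    proof (cases "z \<in> ball p (2 * r)")
      case False
      then have d: "2 * r \<le> dist p z" "p \<noteq> z" using \<open>0 < r\<close> by auto
      have "norm (k x z - k p z) \<le> M * dist p x powr \<epsilon> * dist p z powr (- n - \<epsilon>)"
        using k_reg[of p z x] d assms by (simp add: norm_minus_commute)
      also have "\<dots> \<le> M * r powr \<epsilon> * dist p z powr (- n - \<epsilon>)"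
        by (intro mult_right_mono mult_left_mono powr_mono2) (use assms M_pos eps_pos in auto)
      finally have "norm ((k x z - k p z) * h z) \<le> (M * r powr \<epsilon> * dist p z powr (- n - \<epsilon>)) * (B * dist p z powr \<beta>)"
        unfolding norm_mult using False hz M_pos B(1) by (intro mult_mono) auto
      also have "\<dots> = M * r powr \<epsilon> * B * (dist p z powr (- n - \<epsilon>) * dist p z powr \<beta>)" by (simp only: mult_ac)
      also have "\<dots> = M * r powr \<epsilon> * B * dist p z powr (- n - (\<epsilon> - \<beta>))"
        by (subst powr_add[symmetric]) (simp add: algebra_simps)
      finally show ?thesis using False by (simp add: u_def)
    qed (auto simp: u_def)
  qed
  show "integrable \<mu> (\<lambda>z. indicator (- ball p (2 * r)) z *\<^sub>R ((k x z - k p z) * h z))"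
    by (rule integrable_dominated(1)[OF i m le])
  have "norm (\<integral>z. indicator (- ball p (2 * r)) z *\<^sub>R ((k x z - k p z) * h z) \<partial>\<mu>) \<le> (\<integral>z. u z \<partial>\<mu>)"
    by (rule integrable_dominated(2)[OF i m le])
  also have "\<dots> = M * r powr \<epsilon> * B * (\<integral>z. indicator (- ball p (2 * r)) z * dist p z powr (- n - (\<epsilon> - \<beta>)) \<partial>\<mu>)"
    unfolding u_def by simp
  also have "\<dots> \<le> M * r powr \<epsilon> * B * (far_const (\<epsilon> - \<beta>) * (2 * r) powr (- (\<epsilon> - \<beta>)))"
    by (intro mult_left_mono far_const) (use assms M_pos in auto)
  also have "\<dots> \<le> M * r powr \<epsilon> * B * (far_const (\<epsilon> - \<beta>) * r powr (- (\<epsilon> - \<beta>)))"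
    by (intro mult_left_mono powr_mono2') (use assms M_pos fc in auto)
  also have "\<dots> = M * B * far_const (\<epsilon> - \<beta>) * (r powr \<epsilon> * r powr (- (\<epsilon> - \<beta>)))" by (simp only: mult_ac)
  also have "r powr \<epsilon> * r powr (- (\<epsilon> - \<beta>)) = r powr \<beta>" by (subst powr_add[symmetric]) simp
  finally show "norm (\<integral>z. indicator (- ball p (2 * r)) z *\<^sub>R ((k x z - k p z) * h z) \<partial>\<mu>)
       \<le> M * B * far_const (\<epsilon> - \<beta>) * r powr \<beta>" .
qed

text \<open>Formally \<open>T\<^sub>B f(x)\<close> is the integral of \<open>(k x z - W p r z) * f z\<close> for \<open>B = ball p r\<close>, so
  passing to another ball adds an integral of \<open>(W p r z - W q s z) * f z\<close>, which converges and does
  not depend on \<open>x\<close>.\<close>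

definition W :: "'a \<Rightarrow> real \<Rightarrow> 'a \<Rightarrow> 'k" where
  "W p r z = indicator (- ball p (2 * r)) z *\<^sub>R k p z"

lemma W_measurable [measurable]: "W p r \<in> borel_measurable \<mu>"
  unfolding W_def by measurable

lemma far_grows:
  assumes "grows \<alpha> h" "0 \<le> \<alpha>" "\<alpha> < \<epsilon>" "0 < r" "dist p x \<le> r"
  shows "integrable \<mu> (\<lambda>z. indicator (- ball p (2 * r)) z *\<^sub>R ((k x z - k p z) * h z))"
proof -
  obtain B where "0 \<le> B" "AE z in \<mu>. z \<notin> ball p (2*r) \<longrightarrow> norm (h z) \<le> B * dist p z powr \<alpha>"
    using grows_outside[OF assms(1,2), of "2*r" p] assms by auto
  then show ?thesis using assms by (intro far_kernel_integrable(1)) (auto simp: grows_def)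
qed

lemma bounded_grows:
  assumes "grows \<alpha> h" "0 \<le> \<alpha>" and E: "E \<in> sets borel" "bounded E" and \<rho>: "0 < \<rho>" "E \<inter> ball x \<rho> = {}"
  shows "integrable \<mu> (\<lambda>z. indicator E z *\<^sub>R (k x z * h z))"
proof -
  obtain b where "0 \<le> b" "AE z in \<mu>. z \<in> E \<longrightarrow> norm (h z) \<le> b"
    using grows_bounded[OF assms(1,2) E(2)] by auto
  then show ?thesis using assms by (intro bounded_kernel_integrable(1)) (auto simp: grows_def)
qed

text \<open>Separately the two products need not be integrable at infinity. Outside a large ball
  their difference is a kernel difference in the first variable; inside it each of them keeps away
  from its pole.\<close>

lemma W_diff_integrable:
  assumes h: "grows \<alpha> h" "0 \<le> \<alpha>" "\<alpha> < \<epsilon>" and "0 < r" "0 < s"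
  shows "integrable \<mu> (\<lambda>z. (W p r z - W q s z) * h z)"
proof -
  \<comment> \<open>The radius is chosen so that \<open>ball p (2 * \<rho>)\<close> contains both
    doubled balls and kernel regularity applies to \<open>p\<close> and \<open>q\<close> outside
    it.\<close>
  define \<rho> where "\<rho> = dist p q + r + s"
  have \<rho>: "0 < \<rho>" "dist p q \<le> \<rho>" using assms by (auto simp: \<rho>_def add_nonneg_pos)
  have sub: "ball p (2*r) \<subseteq> ball p (2*\<rho>)" "ball q (2 * s) \<subseteq> ball p (2*\<rho>)"
  proof -
    have *: "dist p t \<le> dist p q + dist q t" "0 \<le> dist p q" for t by (rule dist_triangle, rule zero_le_dist)
    show "ball p (2*r) \<subseteq> ball p (2*\<rho>)" "ball q (2 * s) \<subseteq> ball p (2*\<rho>)"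
      using assms(4,5) * by (auto simp: \<rho>_def subset_iff) (smt (verit) zero_le_dist)+
  qed
  have 1: "integrable \<mu> (\<lambda>z. indicator (ball p (2*\<rho>) - ball p (2*r)) z *\<^sub>R (k p z * h z))"
    using bounded_grows[OF h(1,2) borel_Diff_ball(1,2)[of p "2*\<rho>" p "2*r"], of "2*r" p] \<open>0 < r\<close> by (simp add: Int_Diff_ball)
  have 2: "integrable \<mu> (\<lambda>z. indicator (ball p (2*\<rho>) - ball q (2 * s)) z *\<^sub>R (k q z * h z))"
    using bounded_grows[OF h(1,2) borel_Diff_ball(1,2)[of p "2*\<rho>" q "2 * s"], of "2 * s" q] \<open>0 < s\<close> by (simp add: Int_Diff_ball)
  have 3: "integrable \<mu> (\<lambda>z. indicator (- ball p (2*\<rho>)) z *\<^sub>R ((k q z - k p z) * h z))"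
    by (rule far_grows[OF h]) (use \<rho> in auto)
  have eq: "(\<lambda>z. (W p r z - W q s z) * h z) = (\<lambda>z. indicator (ball p (2*\<rho>) - ball p (2*r)) z *\<^sub>R (k p z * h z)
      - indicator (ball p (2*\<rho>) - ball q (2 * s)) z *\<^sub>R (k q z * h z)
      - indicator (- ball p (2*\<rho>)) z *\<^sub>R ((k q z - k p z) * h z))"
  proof
    fix z
    show "(W p r z - W q s z) * h z = indicator (ball p (2*\<rho>) - ball p (2*r)) z *\<^sub>R (k p z * h z)
      - indicator (ball p (2*\<rho>) - ball q (2 * s)) z *\<^sub>R (k q z * h z)
      - indicator (- ball p (2*\<rho>)) z *\<^sub>R ((k q z - k p z) * h z)"
      using sub(1)[THEN subsetD, of z] sub(2)[THEN subsetD, of z]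
      by (simp add: W_def indicator_def algebra_simps del: mem_ball)
  qed
  show ?thesis unfolding eq by (intro Bochner_Integration.integrable_diff 1 2 3)
qed

text \<open>This is \<open>T_B(1)\<close> for \<open>B = ball p r\<close>, with values outside
  \<open>B\<close> irrelevant.\<close>

definition T1 :: "'a \<Rightarrow> real \<Rightarrow> 'a \<Rightarrow> 'k" where
  "T1 p r x = T (cut (ball p (2 * r)) (\<lambda>_. 1)) x + (\<integral>z. indicator (- ball p (2 * r)) z *\<^sub>R (k x z - k p z) \<partial>\<mu>)"

lemma L2_cut1:
  assumes "E \<in> sets borel" "bounded E"
  shows "cut E (\<lambda>_. 1::'k) \<in> L2 \<mu>" "(\<integral>z. (norm (cut E (\<lambda>_. 1::'k) z))\<^sup>2 \<partial>\<mu>) \<le> measure \<mu> E"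
proof -
  have *: "(\<lambda>_. 1::'k) \<in> borel_measurable \<mu>" "(0::real) \<le> 1" "AE z in \<mu>. z \<in> E \<longrightarrow> norm (1::'k) \<le> 1"
    by auto
  show "cut E (\<lambda>_. 1::'k) \<in> L2 \<mu>" by (rule L2_cut(1)[OF *(1) assms *(2,3)])
  show "(\<integral>z. (norm (cut E (\<lambda>_. 1::'k) z))\<^sup>2 \<partial>\<mu>) \<le> measure \<mu> E"
    using L2_cut(2)[OF *(1) assms *(2,3)] by (simp only: power_one mult_1)
qed

text \<open>The two truncations differ by the indicator of \<open>D\<close>, which stays at distance
  at least r from each point of \<open>ball p r\<close>, so T of it is a kernel integral there. In
  the sum of all integrands \<open>k x z\<close> then cancels.\<close>

lemma T1_diff_nested:
  assumes "0 < r" "0 < s" "ball p r \<subseteq> ball q s" "ball p (2*r) \<subseteq> ball q (2 * s)"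
  shows "AE x in \<mu>. x \<in> ball p r \<longrightarrow> T1 q s x - T1 p r x = (\<integral>z. (W p r z - W q s z) \<partial>\<mu>)"
proof -
  define D where "D = ball q (2 * s) - ball p (2*r)"
  have D: "D \<in> sets borel" "bounded D" by (auto simp: D_def)
  have "AE x in \<mu>. T (\<lambda>z. cut (ball p (2*r)) (\<lambda>_. 1) z + cut D (\<lambda>_. 1) z) x
      = T (cut (ball p (2*r)) (\<lambda>_. 1)) x + T (cut D (\<lambda>_. 1)) x"
    by (intro T_add L2_cut1 D) auto
  moreover have "(\<lambda>z. cut (ball p (2*r)) (\<lambda>_. 1) z + cut D (\<lambda>_. 1) z :: 'k) = cut (ball q (2 * s)) (\<lambda>_. 1::'k)"
    using assms(4) by (intro ext) (auto simp: D_def split: split_indicator)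
  ultimately have a: "AE x in \<mu>. T (cut (ball q (2 * s)) (\<lambda>_. 1)) x
      = T (cut (ball p (2*r)) (\<lambda>_. 1)) x + T (cut D (\<lambda>_. 1)) x" by simp
  have b: "AE x in \<mu>. x \<notin> closure D \<longrightarrow> T (cut D (\<lambda>_. 1)) x = (\<integral>z. indicator D z *\<^sub>R (k x z * 1) \<partial>\<mu>)"
    by (rule T_rep_cut) (use L2_cut1 D in auto)
  from a b show ?thesis
  proof (eventually_elim, intro impI)
    fix x assume a: "T (cut (ball q (2 * s)) (\<lambda>_. 1)) x = T (cut (ball p (2*r)) (\<lambda>_. 1)) x + T (cut D (\<lambda>_. 1)) x"
      and b: "x \<notin> closure D \<longrightarrow> T (cut D (\<lambda>_. 1)) x = (\<integral>z. indicator D z *\<^sub>R (k x z * 1) \<partial>\<mu>)"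
      and x: "x \<in> ball p r"
    have xq: "x \<in> ball q s" using x assms by auto
    have sep: "D \<inter> ball x r = {}"
    proof -
      have "ball x r \<subseteq> ball p (2*r)"
        using x by (auto simp: subset_iff) (smt (verit) dist_triangle)
      then show ?thesis by (auto simp: D_def)
    qed
    then have "closure D \<inter> ball x r = {}" by (metis open_ball open_Int_closure_eq_empty inf_commute)
    then have "x \<notin> closure D" using \<open>0 < r\<close> by auto
    with b have b': "T (cut D (\<lambda>_. 1)) x = (\<integral>z. indicator D z *\<^sub>R (k x z * 1) \<partial>\<mu>)" by simp
    have g: "grows 0 (\<lambda>_. 1::'k)" by (rule grows_const) simp
    have i1: "integrable \<mu> (\<lambda>z. indicator D z *\<^sub>R (k x z * 1))"
      by (rule bounded_grows[OF g _ D \<open>0 < r\<close> sep]) simp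
    have i2: "integrable \<mu> (\<lambda>z. indicator (- ball p (2 * r)) z *\<^sub>R ((k x z - k p z) * 1))"
      by (rule far_grows[OF g]) (use eps_pos assms x in auto)
    have i3: "integrable \<mu> (\<lambda>z. indicator (- ball q (2 * s)) z *\<^sub>R ((k x z - k q z) * 1))"
      by (rule far_grows[OF g]) (use eps_pos assms xq in auto)
    have "T1 q s x - T1 p r x = (\<integral>z. indicator D z *\<^sub>R (k x z * 1) \<partial>\<mu>)
        + (\<integral>z. indicator (- ball q (2 * s)) z *\<^sub>R ((k x z - k q z) * 1) \<partial>\<mu>)
        - (\<integral>z. indicator (- ball p (2 * r)) z *\<^sub>R ((k x z - k p z) * 1) \<partial>\<mu>)"
      unfolding T1_def a b' by simp
    also have "\<dots> = (\<integral>z. (indicator D z *\<^sub>R (k x z * 1) + indicator (- ball q (2 * s)) z *\<^sub>R ((k x z - k q z) * 1)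
        - indicator (- ball p (2 * r)) z *\<^sub>R ((k x z - k p z) * 1)) \<partial>\<mu>)"
      using i1 i2 i3 by simp
    also have "\<dots> = (\<integral>z. (W p r z - W q s z) \<partial>\<mu>)"
    proof (rule arg_cong[of _ _ "integral\<^sup>L \<mu>"], rule ext)
      fix z
      show "indicator D z *\<^sub>R (k x z * 1) + indicator (- ball q (2 * s)) z *\<^sub>R ((k x z - k q z) * 1)
        - indicator (- ball p (2 * r)) z *\<^sub>R ((k x z - k p z) * 1) = W p r z - W q s z"
        using assms(4)[THEN subsetD, of z]
        by (cases "z \<in> ball p (2*r)"; cases "z \<in> ball q (2 * s)")
           (simp_all only: W_def D_def indicator_simps Compl_iff Diff_iff simp_thms, simp_all add: algebra_simps)
    qed
    finally show "T1 q s x - T1 p r x = (\<integral>z. (W p r z - W q s z) \<partial>\<mu>)" .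
  qed
qed

end

subsection \<open>The constants of \<open>T(1)\<close>\<close>

locale cz_T1 = cz_setup \<mu> n A k T \<epsilon> M N
  for \<mu> :: "'a::euclidean_space measure" and n A
    and k :: "'a \<Rightarrow> 'a \<Rightarrow> 'k::{real_normed_field, banach, second_countable_topology}" and T \<epsilon> M N +
  fixes c :: "'a \<Rightarrow> real \<Rightarrow> 'k"
  assumes T1_const: "\<And>p r. p \<in> msupport \<mu> \<Longrightarrow> 0 < r \<Longrightarrow> AE x in \<mu>. x \<in> ball p r \<longrightarrow> T1 p r x = c p r"
begin

lemma c_diff_nested:
  assumes "p \<in> msupport \<mu>" "q \<in> msupport \<mu>" "0 < r" "0 < s" "ball p r \<subseteq> ball q s" "ball p (2 * r) \<subseteq> ball q (2 * s)"
  shows "c q s - c p r = (\<integral>z. (W p r z - W q s z) \<partial>\<mu>)"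
proof -
  have "AE x in \<mu>. x \<in> ball p r \<longrightarrow> c q s - c p r = (\<integral>z. (W p r z - W q s z) \<partial>\<mu>)"
    using T1_diff_nested[OF assms(3-6)] T1_const[OF assms(1,3)] T1_const[OF assms(2,4)]
    by eventually_elim (use assms(5) in auto)
  then show ?thesis by (rule AE_ball_obtain[OF assms(1,3)])
qed

lemma W_diff_integrable1: "0 < r \<Longrightarrow> 0 < s \<Longrightarrow> integrable \<mu> (\<lambda>z. W p r z - W q s z)"
  using W_diff_integrable[of 0 "\<lambda>_. 1" r s p q] grows_const[of 0 1] eps_pos by simp

text \<open>Both balls are compared with the large ball \<open>ball p R\<close>, and
  \<open>W p R\<close> cancels.\<close>

lemma c_diff:
  assumes "p \<in> msupport \<mu>" "q \<in> msupport \<mu>" "0 < r" "0 < s"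
  shows "c q s - c p r = (\<integral>z. (W p r z - W q s z) \<partial>\<mu>)"
proof -
  define R where "R = dist p q + r + s"
  have R: "0 < R" "dist p q + s \<le> R" "r \<le> R" using assms zero_le_dist[of p q] unfolding R_def by linarith+
  have tri: "dist p t \<le> dist p q + dist q t" for t by (rule dist_triangle)
  have 1: "c p R - c p r = (\<integral>z. (W p r z - W p R z) \<partial>\<mu>)"
    by (rule c_diff_nested) (use assms R in auto)
  have sub: "ball q s \<subseteq> ball p R" "ball q (2 * s) \<subseteq> ball p (2 * R)"
    using R tri by (auto simp: subset_iff) (smt (verit) zero_le_dist)+
  have 2: "c p R - c q s = (\<integral>z. (W q s z - W p R z) \<partial>\<mu>)"
    by (rule c_diff_nested) (use assms R sub in auto)
  have "c q s - c p r = (c p R - c p r) - (c p R - c q s)" by simp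
  also have "\<dots> = (\<integral>z. ((W p r z - W p R z) - (W q s z - W p R z)) \<partial>\<mu>)"
    unfolding 1 2 by (rule Bochner_Integration.integral_diff[symmetric]) (use W_diff_integrable1 assms R in auto)
  finally show ?thesis by simp
qed

lemma measure_ball_pos: "p \<in> msupport \<mu> \<Longrightarrow> 0 < r \<Longrightarrow> 0 < measure \<mu> (ball p r)"
  using finite_ball[of p r] by (auto simp: msupport_def measure_def enn2real_positive_iff)

text \<open>On B the constant is T of the indicator of 2B plus a tail bounded by regularity.
  Integrating squares over B and using the L2 bound gives a multiple of \<mu>(2B), hence of
  \<mu>(B), and \<mu>(B) > 0 divides out.\<close>

lemma c_doubling:
  assumes p: "p \<in> msupport \<mu>" and r: "0 < r" and b: "measure \<mu> (ball p (2 * r)) \<le> b * measure \<mu> (ball p r)"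
  shows "norm (c p r) \<le> sqrt (2 * N * b + 2 * (M * far_const \<epsilon>)\<^sup>2)"
proof -
  define B where "B = ball p r"
  define F where "F = M * far_const \<epsilon>"
  define u where "u = cut (ball p (2 * r)) (\<lambda>_. 1::'k)"
  have u: "u \<in> L2 \<mu>" "(\<integral>z. (norm (u z))\<^sup>2 \<partial>\<mu>) \<le> measure \<mu> (ball p (2 * r))"
    unfolding u_def by (rule L2_cut1; simp)+
  have B: "B \<in> sets borel" "bounded B" "0 < measure \<mu> B" using measure_ball_pos[OF p r] by (auto simp: B_def)
  have tail: "norm (\<integral>z. indicator (- ball p (2 * r)) z *\<^sub>R (k x z - k p z) \<partial>\<mu>) \<le> F" if "x \<in> B" for x
    using far_kernel_integrable(2)[of "\<lambda>_. 1" r p x 0 1] that r eps_pos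
    by (auto simp: B_def F_def)
  have le: "AE x in \<mu>. indicator B x * (norm (c p r))\<^sup>2 \<le> 2 * (norm (T u x))\<^sup>2 + 2 * F\<^sup>2 * indicator B x"
    using T1_const[OF p r]
  proof (rule eventually_mono)
    fix x assume *: "x \<in> ball p r \<longrightarrow> T1 p r x = c p r"
    show "indicator B x * (norm (c p r))\<^sup>2 \<le> 2 * (norm (T u x))\<^sup>2 + 2 * F\<^sup>2 * indicator B x"
    proof (cases "x \<in> B")
      case True
      have "norm (c p r) \<le> norm (T u x) + norm (\<integral>z. indicator (- ball p (2 * r)) z *\<^sub>R (k x z - k p z) \<partial>\<mu>)"
        using * True unfolding T1_def B_def u_def by (metis norm_triangle_ineq)
      also have "\<dots> \<le> norm (T u x) + F" using tail[OF True] by simp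
      finally have "(norm (c p r))\<^sup>2 \<le> (norm (T u x) + F)\<^sup>2" by (rule power_mono) simp
      also have "\<dots> \<le> 2 * (norm (T u x))\<^sup>2 + 2 * F\<^sup>2"
        using zero_le_power2[of "norm (T u x) - F"] by (simp add: power2_eq_square algebra_simps)
      finally show ?thesis using True by simp
    qed simp
  qed
  have iB: "integrable \<mu> (indicator B :: 'a \<Rightarrow> real)" by (rule integrable_indicator_bounded) (use B in auto)
  have iT: "integrable \<mu> (\<lambda>x. (norm (T u x))\<^sup>2)" by (rule T_sq_integrable[OF u(1)])
  have "(\<integral>x. indicator B x * (norm (c p r))\<^sup>2 \<partial>\<mu>) \<le> (\<integral>x. (2 * (norm (T u x))\<^sup>2 + 2 * F\<^sup>2 * indicator B x) \<partial>\<mu>)"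
    by (rule integral_mono_AE) (use le iB iT in auto)
  also have "\<dots> = 2 * (\<integral>x. (norm (T u x))\<^sup>2 \<partial>\<mu>) + 2 * F\<^sup>2 * measure \<mu> B"
    using iB iT by simp
  also have "\<dots> \<le> 2 * (N * (b * measure \<mu> B)) + 2 * F\<^sup>2 * measure \<mu> B"
  proof -
    have "(\<integral>x. (norm (T u x))\<^sup>2 \<partial>\<mu>) \<le> N * (\<integral>z. (norm (u z))\<^sup>2 \<partial>\<mu>)" by (rule T_bound[OF u(1)])
    also have "\<dots> \<le> N * (b * measure \<mu> B)"
      by (rule mult_left_mono) (use u(2) b N_pos in \<open>auto simp: B_def\<close>)
    finally show ?thesis by simp
  qed
  finally have "measure \<mu> B * (norm (c p r))\<^sup>2 \<le> measure \<mu> B * (2 * N * b + 2 * F\<^sup>2)"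
    by (simp add: algebra_simps)
  then have "(norm (c p r))\<^sup>2 \<le> 2 * N * b + 2 * F\<^sup>2" using B(3) by simp
  then show ?thesis unfolding F_def by (rule real_le_rsqrt)
qed

text \<open>\<open>W p r\<close> and \<open>W p (2 * r)\<close> differ only on the annulus between
  the radii 2r and 4r, where the kernel is at most \<open>M * (2 * r) powr (- n)\<close>. This is
  why the density two scales up enters \<open>doubling_sequence\<close>.\<close>

lemma c_step:
  assumes p: "p \<in> msupport \<mu>" and r: "0 < r"
  shows "norm (c p r) \<le> norm (c p (2 * r)) + M * (2 * r) powr (- n) * measure \<mu> (ball p (4 * r))"
proof -
  define E where "E = ball p (4 * r) - ball p (2 * r)"
  have E: "E \<in> sets borel" "bounded E" by (auto simp: E_def)
  have "c p (2 * r) - c p r = (\<integral>z. (W p r z - W p (2 * r) z) \<partial>\<mu>)"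
    by (rule c_diff) (use p r in auto)
  also have "(\<lambda>z. W p r z - W p (2 * r) z) = (\<lambda>z. indicator E z *\<^sub>R (k p z * 1))"
    using r by (intro ext) (auto simp: W_def E_def indicator_def)
  finally have "norm (c p (2 * r) - c p r) = norm (\<integral>z. indicator E z *\<^sub>R (k p z * 1) \<partial>\<mu>)" by simp
  also have "\<dots> \<le> M * (2 * r) powr (- n) * 1 * measure \<mu> E"
    by (rule bounded_kernel_integrable(2)) (use E r in \<open>auto simp: E_def\<close>)
  also have "\<dots> \<le> M * (2 * r) powr (- n) * 1 * measure \<mu> (ball p (4 * r))"
    by (intro mult_left_mono measure_mono_fmeasurable fmeasurableI)
       (use E M_pos finite_ball in \<open>auto simp: E_def sets_mu\<close>)
  finally have "norm (c p (2 * r) - c p r) \<le> M * (2 * r) powr (- n) * measure \<mu> (ball p (4 * r))" by simp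
  moreover have "norm (c p r) \<le> norm (c p (2 * r)) + norm (c p (2 * r) - c p r)"
    using norm_triangle_ineq4[of "c p (2 * r)" "c p (2 * r) - c p r"] by simp
  ultimately show ?thesis by linarith
qed

lemma c_bounded: "\<exists>C0\<ge>0. \<forall>p\<in>msupport \<mu>. \<forall>r>0. norm (c p r) \<le> C0"
proof -
  \<comment> \<open>A density that at most doubles from one scale to the next means \<open>measure
    \<mu> (ball p (2 * r)) \<le> 2 * 2 powr n * measure \<mu> (ball p r)\<close>; this is the
    \<open>b\<close> of \<open>c_doubling\<close>.\<close>
  define D where "D = sqrt (2 * N * (2 * 2 powr n) + 2 * (M * far_const \<epsilon>)\<^sup>2)"
  have D: "0 \<le> D" using N_pos by (auto simp: D_def)
  have A': "0 \<le> M * 2 powr n" using M_pos by simp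
  have "norm (c p r) \<le> D + 3 * (M * 2 powr n) * A" if p: "p \<in> msupport \<mu>" and r: "0 < r" for p r
  proof -
    define t where "t j = 2 ^ j * r" for j :: nat
    have t: "0 < t j" "t (j+1) = 2 * t j" "t (j+2) = 4 * t j" for j using r by (auto simp: t_def)
    define m where "m j = measure \<mu> (ball p (t j)) / t j powr n" for j
    have mt: "measure \<mu> (ball p (t j)) = m j * t j powr n" for j using t(1)[of j] by (simp add: m_def)
    have t2: "t (j+1) powr n = 2 powr n * t j powr n" for j
      unfolding t(2) using t(1)[of j] by (simp add: powr_mult)
    have "norm (c p (t 0)) \<le> D + 3 * (M * 2 powr n) * A"
    proof (rule doubling_sequence[of m A "M * 2 powr n" D "\<lambda>j. norm (c p (t j))"])
      show "0 < m 0" using measure_ball_pos[OF p] t(1)[of 0] by (simp add: m_def)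
      show "0 \<le> m j" for j by (simp add: m_def)
      show "m j \<le> A" for j using measure_ball_le[OF t(1)[of j], of p] t(1)[of j] by (simp add: m_def divide_le_eq)
      \<comment> \<open>\<open>c_step\<close> divides \<mu>(4B) by the power of the radius of 2B,
        while the density uses the radius of 4B; the quotient is \<open>2 powr n\<close>.\<close>
      show "norm (c p (t j)) \<le> norm (c p (t (j+1))) + M * 2 powr n * m (j+2)" for j
      proof -
        have "t (j+2) powr n = (2 * (2 * t j)) powr n" unfolding t(3) by simp
        also have "\<dots> = 2 powr n * (2 * t j) powr n" using t(1)[of j] by (subst powr_mult) auto
        finally have t3: "t (j+2) powr n = 2 powr n * (2 * t j) powr n" .
        have "(2 * t j) powr (- n) * measure \<mu> (ball p (4 * t j)) = (2 * t j) powr (- n) * (m (j+2) * t (j+2) powr n)"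
          using mt[of "j+2"] unfolding t(3) by simp
        also have "\<dots> = 2 powr n * m (j+2) * ((2 * t j) powr (- n) * (2 * t j) powr n)"
          unfolding t3 by (simp only: mult_ac)
        also have "(2 * t j) powr (- n) * (2 * t j) powr n = 1" using t(1)[of j] by (simp add: powr_minus)
        finally have "(2 * t j) powr (- n) * measure \<mu> (ball p (4 * t j)) = 2 powr n * m (j+2)" by simp
        then have "M * ((2 * t j) powr (- n) * measure \<mu> (ball p (4 * t j))) = M * (2 powr n * m (j+2))" by simp
        then show ?thesis using c_step[OF p t(1)[of j]] unfolding t(2) by (simp only: mult.assoc)
      qed
      show "norm (c p (t j)) \<le> D" if "m (j+1) \<le> 2 * m j" for j
        unfolding D_def
      proof (rule c_doubling[OF p t(1)])
        have "m (j+1) * t (j+1) powr n \<le> (2 * m j) * t (j+1) powr n" using that by (rule mult_right_mono) simp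
        then show "measure \<mu> (ball p (2 * t j)) \<le> 2 * 2 powr n * measure \<mu> (ball p (t j))"
          using mt[of "j+1"] mt[of j] unfolding t2 unfolding t(2) by (simp only: mult_ac)
      qed
    qed (use D A' in auto)
    then show ?thesis by (simp add: t_def)
  qed
  moreover have "0 \<le> D + 3 * (M * 2 powr n) * A" using D A' A_nonneg by (intro add_nonneg_nonneg mult_nonneg_nonneg[of _ A]) (use A' in auto)
  ultimately show ?thesis by blast
qed

end

subsection \<open>The commutator with a Lipschitz function\<close>

context cz_setup begin

lemma T_sum:
  assumes "\<And>i. u i \<in> L2 \<mu>" "\<And>j. (\<lambda>z. \<Sum>i<j. u i z) \<in> L2 \<mu>"
  shows "AE x in \<mu>. T (\<lambda>z. \<Sum>i<(m::nat). u i z) x = (\<Sum>i<m. T (u i) x)"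
proof (induction m)
  case 0
  have "AE x in \<mu>. T (\<lambda>y. 0 * u 0 y) x = 0 * T (u 0) x" by (rule T_cmult) (rule assms)
  then show ?case by simp
next
  case (Suc m)
  have "AE x in \<mu>. T (\<lambda>y. (\<Sum>i<m. u i y) + u m y) x = T (\<lambda>y. \<Sum>i<m. u i y) x + T (u m) x"
    by (rule T_add) (rule assms)+
  with Suc show ?case by eventually_elim simp
qed

end

text \<open>\<open>L\<close> is positive even for constant \<open>f\<close>, because
  \<open>defect_small\<close> divides by a multiple of it.\<close>

locale cz_lip = cz_setup \<mu> n A k T \<epsilon> M N
  for \<mu> :: "'a::euclidean_space measure" and n A
    and k :: "'a \<Rightarrow> 'a \<Rightarrow> 'k::{real_normed_field, banach, second_countable_topology}" and T \<epsilon> M N +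
  fixes f :: "'a \<Rightarrow> 'k" and G :: "'a set" and \<alpha> L :: real
  assumes alpha: "0 < \<alpha>" "\<alpha> < \<epsilon>" and G_AE: "AE x in \<mu>. x \<in> G" and G_supp: "G \<subseteq> msupport \<mu>"
    and f_measurable [measurable]: "f \<in> borel_measurable \<mu>" and L_pos: "0 < L"
    and f_lip: "\<And>x y. x \<in> G \<Longrightarrow> y \<in> G \<Longrightarrow> norm (f x - f y) \<le> L * dist x y powr \<alpha>"
begin

lemma f_minus_bound: "x \<in> G \<Longrightarrow> AE z in \<mu>. norm (f z - f x) \<le> L * dist x z powr \<alpha>"
  using G_AE by (rule eventually_mono) (metis f_lip dist_commute)

lemma f_minus_grows: "x \<in> G \<Longrightarrow> grows \<alpha> (\<lambda>z. f z - f x)"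
proof (rule growsI[of _ _ L x])
  assume "x \<in> G"
  from f_minus_bound[OF this] show "AE z in \<mu>. norm (f z - f x) \<le> L * (1 + dist x z powr \<alpha>)"
    by (rule eventually_mono) (use L_pos in \<open>auto simp: algebra_simps\<close>)
qed (use alpha L_pos in auto)

lemma f_grows: "grows \<alpha> f"
  by (rule lip_grows[OF f_measurable G_AE _ _ f_lip]) (use alpha L_pos in auto)

lemma L2_cut_f: "E \<in> sets borel \<Longrightarrow> bounded E \<Longrightarrow> cut E f \<in> L2 \<mu>"
  using grows_bounded[OF f_grows, of E] alpha L2_cut(1)[OF f_measurable, of E] by fastforce

lemma local_integrable:
  assumes "x \<in> G" "E \<in> sets borel" "bounded E"
  shows "integrable \<mu> (\<lambda>z. indicator E z *\<^sub>R (k x z * (f z - f x)))"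
proof -
  obtain \<rho> where \<rho>: "0 < \<rho>" "E \<subseteq> ball x \<rho>" using bounded_subset_ballD[OF assms(3)] by blast
  show ?thesis
    by (rule near_kernel_integrable(1)[OF _ assms(2) \<rho>(2,1) alpha(1) _ f_minus_bound[OF assms(1)]]) (use L_pos in auto)
qed

text \<open>The commutator of \<open>T\<close> with multiplication by \<open>f\<close>, applied to the indicator function of \<open>E\<close>,
  minus the weakly singular integral that represents it.\<close>

definition defect :: "'a set \<Rightarrow> 'a \<Rightarrow> 'k" where
  "defect E x = T (cut E f) x - f x * T (cut E (\<lambda>_. 1)) x - (\<integral>z. indicator E z *\<^sub>R (k x z * (f z - f x)) \<partial>\<mu>)"

lemma defect_measurable [measurable]:
  assumes "E \<in> sets borel" "bounded E"
  shows "defect E \<in> borel_measurable \<mu>"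
proof -
  interpret sigma_finite_measure \<mu> by (rule sigma_finite)
  have [measurable]: "E \<in> sets \<mu>" using assms by (simp add: sets_mu)
  have [measurable]: "T (cut E f) \<in> borel_measurable \<mu>" "T (cut E (\<lambda>_. 1)) \<in> borel_measurable \<mu>"
    using L2_cut_f[OF assms] L2_cut1[OF assms] by auto
  show ?thesis unfolding defect_def by measurable
qed

text \<open>Away from \<open>closure E\<close> both values of T are kernel integrals, which split
  and cancel against the third term.\<close>

lemma defect_off:
  assumes E: "E \<in> sets borel" "bounded E"
  shows "AE x in \<mu>. x \<notin> closure E \<longrightarrow> defect E x = 0"
  using T_rep_cut[OF L2_cut_f[OF E] E(2)] T_rep_cut[OF L2_cut1(1)[OF E] E(2)]
proof (eventually_elim, intro impI)
  fix x assume 1: "x \<notin> closure E \<longrightarrow> T (cut E f) x = (\<integral>z. indicator E z *\<^sub>R (k x z * f z) \<partial>\<mu>)"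
    and 2: "x \<notin> closure E \<longrightarrow> T (cut E (\<lambda>_. 1)) x = (\<integral>z. indicator E z *\<^sub>R (k x z * 1) \<partial>\<mu>)"
    and x: "x \<notin> closure E"
  have "open (- closure E)" by (rule open_Compl[OF closed_closure])
  then obtain \<rho> where \<rho>: "0 < \<rho>" "ball x \<rho> \<subseteq> - closure E" using x by (meson ComplI openE)
  then have \<rho>': "E \<inter> ball x \<rho> = {}" using closure_subset by blast
  have i1: "integrable \<mu> (\<lambda>z. indicator E z *\<^sub>R (k x z * f z))"
    by (rule bounded_grows[OF f_grows _ E \<rho>(1) \<rho>']) (use alpha in simp)
  have i2: "integrable \<mu> (\<lambda>z. indicator E z *\<^sub>R (k x z * 1))"
    by (rule bounded_grows[OF grows_const[of 0 1] _ E \<rho>(1) \<rho>']) auto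
  have "(\<integral>z. indicator E z *\<^sub>R (k x z * (f z - f x)) \<partial>\<mu>)
      = (\<integral>z. (indicator E z *\<^sub>R (k x z * f z) - f x * (indicator E z *\<^sub>R (k x z * 1))) \<partial>\<mu>)"
    by (rule Bochner_Integration.integral_cong) (auto simp: algebra_simps split: split_indicator)
  also have "\<dots> = (\<integral>z. indicator E z *\<^sub>R (k x z * f z) \<partial>\<mu>) - (\<integral>z. f x * (indicator E z *\<^sub>R (k x z * 1)) \<partial>\<mu>)"
    by (intro Bochner_Integration.integral_diff i1 integrable_mult_right i2)
  also have "(\<integral>z. f x * (indicator E z *\<^sub>R (k x z * 1)) \<partial>\<mu>) = f x * (\<integral>z. indicator E z *\<^sub>R (k x z * 1) \<partial>\<mu>)"
    by (rule integral_mult_right_zero)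
  finally show "defect E x = 0" unfolding defect_def using 1 2 x by simp
qed

text \<open>With a reference point \<open>x1\<close> in \<open>P\<close>, the commutator applied to
  the indicator of \<open>E\<close> is T((f - f(x1)) 1_E) - (f(x) - f(x1)) T(1_E), and f - f(x1) is
  at most \<eta> a.e. on \<open>P\<close>. The L2 bound for inputs supported in \<open>P\<close>,
  tested on \<open>P\<close>, makes both terms O(\<eta> \<mu>(P)); the weakly singular integral is
  O(\<eta>) pointwise.\<close>

lemma defect_small:
  assumes P: "P \<in> sets borel" "P \<subseteq> ball q \<delta>" "0 < \<delta>" and E: "E \<in> sets borel" "E \<subseteq> P"
  shows "(\<integral>\<^sup>+x. ennreal (norm (defect E x)) * indicator P x \<partial>\<mu>)
    \<le> ennreal ((N + 1 + M * near_const \<alpha>) * (L * (2 * \<delta>) powr \<alpha>)) * emeasure \<mu> P"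
proof (cases "P \<inter> G = {}")
  case True
  have "AE x in \<mu>. ennreal (norm (defect E x)) * indicator P x = 0"
    using G_AE by (rule eventually_mono) (use True in \<open>auto split: split_indicator\<close>)
  then have "(\<integral>\<^sup>+x. ennreal (norm (defect E x)) * indicator P x \<partial>\<mu>) = (\<integral>\<^sup>+x. 0 \<partial>\<mu>)"
    by (rule nn_integral_cong_AE)
  then show ?thesis by simp
next
  case False
  then obtain x1 where x1: "x1 \<in> P" "x1 \<in> G" by auto
  define \<eta> where "\<eta> = L * (2 * \<delta>) powr \<alpha>"
  have eta: "0 < \<eta>" using L_pos P(3) by (simp add: \<eta>_def)
  have bP: "bounded P" "bounded E" using P(2) E(2) bounded_subset[OF bounded_ball] by blast+
  have near: "dist x y < 2 * \<delta>" if "x \<in> P" "y \<in> P" for x y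
  proof -
    have "dist q x < \<delta>" "dist q y < \<delta>" using that P(2) by auto
    then show ?thesis using dist_triangle3[of x y q] by linarith
  qed
  have osc: "norm (f x - f y) \<le> \<eta>" if "x \<in> P" "y \<in> P" "x \<in> G" "y \<in> G" for x y
  proof -
    have "norm (f x - f y) \<le> L * dist x y powr \<alpha>" by (rule f_lip) (use that in auto)
    also have "\<dots> \<le> \<eta>" unfolding \<eta>_def
      by (intro mult_left_mono powr_mono2) (use near[of x y] that alpha L_pos in auto)
    finally show ?thesis .
  qed
  define u where "u = cut E (\<lambda>z. f z - f x1)"
  define v where "v = cut E (\<lambda>_. 1::'k)"
  have ub: "AE z in \<mu>. z \<in> E \<longrightarrow> norm (f z - f x1) \<le> \<eta>"
    using G_AE by (rule eventually_mono) (use osc x1 E in auto)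
  have um: "(\<lambda>z. f z - f x1) \<in> borel_measurable \<mu>" by measurable
  have eta0: "0 \<le> \<eta>" using eta by simp
  have u: "u \<in> L2 \<mu>" "(\<integral>z. (norm (u z))\<^sup>2 \<partial>\<mu>) \<le> \<eta>\<^sup>2 * measure \<mu> E"
    unfolding u_def by (rule L2_cut[OF um E(1) bP(2) eta0 ub])+
  have v: "v \<in> L2 \<mu>" "(\<integral>z. (norm (v z))\<^sup>2 \<partial>\<mu>) \<le> measure \<mu> E"
    unfolding v_def by (rule L2_cut1[OF E(1) bP(2)])+
  have mE: "measure \<mu> E \<le> measure \<mu> P"
    by (intro measure_mono_fmeasurable fmeasurableI) (use E P finite_bounded bP in \<open>auto simp: sets_mu\<close>)
  have Tu: "AE x in \<mu>. T u x = T (cut E f) x - f x1 * T v x"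
  proof -
    have fE: "cut E f \<in> L2 \<mu>" by (rule L2_cut_f[OF E(1) bP(2)])
    have cv: "(\<lambda>y. (- f x1) * v y) \<in> L2 \<mu>"
    proof -
      have "AE z in \<mu>. z \<in> E \<longrightarrow> norm (- f x1) \<le> norm (f x1)" by simp
      then have "cut E (\<lambda>_. - f x1) \<in> L2 \<mu>" by (intro L2_cut(1)[OF _ E(1) bP(2), of _ "norm (f x1)"]) auto
      moreover have "cut E (\<lambda>_. - f x1) = (\<lambda>y. (- f x1) * v y)" by (intro ext) (simp add: v_def split: split_indicator)
      ultimately show ?thesis by simp
    qed
    have ueq: "u = (\<lambda>y. cut E f y + (- f x1) * v y)"
      by (intro ext) (simp add: u_def v_def split: split_indicator)
    from T_add[OF fE cv] T_cmult[OF v(1), of "- f x1"] show ?thesis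
      unfolding ueq by eventually_elim simp
  qed
  \<comment> \<open>Young's inequality replaces Cauchy-Schwarz. The first term is weighted by \<eta>
    because the squared norm of \<open>T u\<close> is at most
    \<open>N * \<eta>\<^sup>2 * measure \<mu> P\<close>, while that of \<open>T v\<close> has no
    factor \<eta>.\<close>
  define w where "w x = ((norm (T u x))\<^sup>2 / \<eta> + \<eta> * indicator P x + \<eta> * (norm (T v x))\<^sup>2 + \<eta> * indicator P x) / 2
      + M * near_const \<alpha> * \<eta> * indicator P x" for x
  have w0: "0 \<le> w x" for x unfolding w_def using eta M_pos near_const(1)[OF alpha(1)] by simp
  have le: "AE x in \<mu>. norm (defect E x) * indicator P x \<le> w x"
    using Tu G_AE
  proof eventually_elim
    fix x assume T: "T u x = T (cut E f) x - f x1 * T v x" and xG: "x \<in> G"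
    show "norm (defect E x) * indicator P x \<le> w x"
    proof (cases "x \<in> P")
      case False then show ?thesis using w0 by simp
    next
      case xP: True
      define I where "I = (\<integral>z. indicator E z *\<^sub>R (k x z * (f z - f x)) \<partial>\<mu>)"
      have "E \<subseteq> ball x (2 * \<delta>)" using near[OF xP] E(2) by auto
      then have I: "norm I \<le> M * L * near_const \<alpha> * (2 * \<delta>) powr \<alpha>"
        unfolding I_def
        by (intro near_kernel_integrable(2)[OF _ E(1) _ _ alpha(1) _ f_minus_bound[OF xG]]) (use L_pos P(3) in auto)
      have "defect E x = T u x - (f x - f x1) * T v x - I"
        unfolding defect_def I_def T v_def by (simp add: algebra_simps)
      then have "norm (defect E x) \<le> norm (T u x) + norm ((f x - f x1) * T v x) + norm I"
        by (metis (no_types, opaque_lifting) add_mono_thms_linordered_semiring(3) norm_triangle_ineq4 order_trans)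
      also have "norm ((f x - f x1) * T v x) \<le> \<eta> * norm (T v x)"
        unfolding norm_mult by (intro mult_right_mono osc) (use xP xG x1 in auto)
      also have "norm (T u x) \<le> ((norm (T u x))\<^sup>2 / \<eta> + \<eta>) / 2"
      proof -
        have "0 \<le> (norm (T u x) - \<eta>)\<^sup>2 / \<eta>" using eta by simp
        also have "\<dots> = (norm (T u x))\<^sup>2 / \<eta> + \<eta> - 2 * norm (T u x)"
          using eta by (simp add: power2_eq_square field_simps)
        finally show ?thesis by simp
      qed
      also have "\<eta> * norm (T v x) \<le> \<eta> * (((norm (T v x))\<^sup>2 + 1) / 2)"
      proof (intro mult_left_mono)
        show "norm (T v x) \<le> ((norm (T v x))\<^sup>2 + 1) / 2"
          using zero_le_power2[of "norm (T v x) - 1"] by (simp add: power2_eq_square algebra_simps)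
      qed (use eta in simp)
      also note I
      finally show ?thesis using xP by (simp add: w_def \<eta>_def algebra_simps add_divide_distrib)
    qed
  qed
  have iP: "integrable \<mu> (indicator P :: 'a \<Rightarrow> real)" by (rule integrable_indicator_bounded) (use P bP in auto)
  note iu = T_sq_integrable[OF u(1)] and iv = T_sq_integrable[OF v(1)]
  have iw: "integrable \<mu> w" unfolding w_def using iP iu iv by simp
  have "(\<integral>x. w x \<partial>\<mu>) = ((\<integral>x. (norm (T u x))\<^sup>2 \<partial>\<mu>) / \<eta> + \<eta> * measure \<mu> P + \<eta> * (\<integral>x. (norm (T v x))\<^sup>2 \<partial>\<mu>) + \<eta> * measure \<mu> P) / 2
      + M * near_const \<alpha> * \<eta> * measure \<mu> P"
    unfolding w_def using iP iu iv by simp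
  also have "\<dots> \<le> (N * (\<eta>\<^sup>2 * measure \<mu> P) / \<eta> + \<eta> * measure \<mu> P + \<eta> * (N * measure \<mu> P) + \<eta> * measure \<mu> P) / 2
      + M * near_const \<alpha> * \<eta> * measure \<mu> P"
  proof -
    have "N * (\<integral>z. (norm (u z))\<^sup>2 \<partial>\<mu>) \<le> N * (\<eta>\<^sup>2 * measure \<mu> P)"
      by (rule mult_left_mono, rule order_trans[OF u(2)]) (use mE N_pos in \<open>auto intro: mult_left_mono\<close>)
    then have 1: "(\<integral>x. (norm (T u x))\<^sup>2 \<partial>\<mu>) \<le> N * (\<eta>\<^sup>2 * measure \<mu> P)" using T_bound[OF u(1)] by simp
    have "N * (\<integral>z. (norm (v z))\<^sup>2 \<partial>\<mu>) \<le> N * measure \<mu> P"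
      by (rule mult_left_mono, rule order_trans[OF v(2)]) (use mE N_pos in auto)
    then have 2: "(\<integral>x. (norm (T v x))\<^sup>2 \<partial>\<mu>) \<le> N * measure \<mu> P" using T_bound[OF v(1)] by simp
    show ?thesis
      by (intro add_right_mono divide_right_mono add_mono mult_left_mono order_refl 1 2) (use eta in auto)
  qed
  also have "\<dots> = (N + 1 + M * near_const \<alpha>) * \<eta> * measure \<mu> P"
    using eta by (simp add: power2_eq_square field_simps)
  finally have wle: "(\<integral>x. w x \<partial>\<mu>) \<le> (N + 1 + M * near_const \<alpha>) * \<eta> * measure \<mu> P" .
  have "(\<integral>\<^sup>+x. ennreal (norm (defect E x)) * indicator P x \<partial>\<mu>) \<le> (\<integral>\<^sup>+x. ennreal (w x) \<partial>\<mu>)"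
    by (rule nn_integral_mono_AE, rule eventually_mono[OF le])
       (auto split: split_indicator_asm simp: w0 intro: ennreal_leI)
  also have "\<dots> = ennreal (\<integral>x. w x \<partial>\<mu>)" by (rule nn_integral_eq_integral[OF iw]) (use w0 in auto)
  also have "\<dots> \<le> ennreal ((N + 1 + M * near_const \<alpha>) * \<eta> * measure \<mu> P)" by (rule ennreal_leI[OF wle])
  also have "\<dots> = ennreal ((N + 1 + M * near_const \<alpha>) * \<eta>) * ennreal (measure \<mu> P)"
    by (rule ennreal_mult) (use eta M_pos N_pos near_const(1)[OF alpha(1)] in auto)
  also have "ennreal (measure \<mu> P) = emeasure \<mu> P"
    using finite_bounded[OF bP(1)] by (simp add: emeasure_eq_ennreal_measure)
  finally show ?thesis unfolding \<eta>_def .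
qed

lemma defect_decompose:
  assumes E: "E \<in> sets borel" "bounded E" and P: "\<And>i. P i \<in> sets borel" "disjoint_family P" "E \<subseteq> (\<Union>i<m. P i)"
  shows "AE x in \<mu>. defect E x = (\<Sum>i<(m::nat). defect (E \<inter> P i) x)"
proof -
  have EP: "E \<inter> P i \<in> sets borel" "bounded (E \<inter> P i)" for i using E P by (auto intro: bounded_subset)
  have ind: "(\<Sum>i<j. indicator (E \<inter> P i) z) = (indicator (\<Union>i<j. E \<inter> P i) z :: real)" for z j
    by (rule indicator_UN_disjoint[symmetric])
       (use P(2) in \<open>auto simp: disjoint_family_on_def\<close>)
  have U: "(\<Union>i<m. E \<inter> P i) = E" using P(3) by auto
  \<comment> \<open>Since the pieces are disjoint, partial sums of cut-offs are cut-offs to partial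
    unions, hence in \<open>L2 \<mu>\<close> as \<open>T_sum\<close> requires.\<close>
  have cuts: "(\<lambda>z. \<Sum>i<j. cut (E \<inter> P i) h z) = cut (\<Union>i<j. E \<inter> P i) h" for h :: "'a \<Rightarrow> 'k" and j
    by (intro ext) (simp only: scaleR_left.sum[symmetric] ind)
  have Uj: "(\<Union>i<j. E \<inter> P i) \<in> sets borel" "bounded (\<Union>i<j. E \<inter> P i)" for j
  proof -
    show "(\<Union>i<j. E \<inter> P i) \<in> sets borel" by (rule sets.finite_UN) (use EP in auto)
    show "bounded (\<Union>i<j. E \<inter> P i)" by (rule bounded_subset[OF E(2)]) auto
  qed
  have 1: "AE x in \<mu>. T (\<lambda>z. \<Sum>i<m. cut (E \<inter> P i) f z) x = (\<Sum>i<m. T (cut (E \<inter> P i) f) x)"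
    by (rule T_sum) (use L2_cut_f EP Uj in \<open>auto simp only: cuts\<close>)
  have 2: "AE x in \<mu>. T (\<lambda>z. \<Sum>i<m. cut (E \<inter> P i) (\<lambda>_. 1) z) x = (\<Sum>i<m. T (cut (E \<inter> P i) (\<lambda>_. 1)) x)"
    by (rule T_sum) (use L2_cut1(1) EP Uj in \<open>auto simp only: cuts\<close>)
  from 1 2 G_AE show ?thesis
  proof eventually_elim
    fix x assume 1: "T (\<lambda>z. \<Sum>i<m. cut (E \<inter> P i) f z) x = (\<Sum>i<m. T (cut (E \<inter> P i) f) x)"
      and 2: "T (\<lambda>z. \<Sum>i<m. cut (E \<inter> P i) (\<lambda>_. 1) z) x = (\<Sum>i<m. T (cut (E \<inter> P i) (\<lambda>_. 1)) x)"
      and x: "x \<in> G"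
    have 3: "(\<integral>z. indicator E z *\<^sub>R (k x z * (f z - f x)) \<partial>\<mu>)
        = (\<Sum>i<m. (\<integral>z. indicator (E \<inter> P i) z *\<^sub>R (k x z * (f z - f x)) \<partial>\<mu>))"
    proof -
      have "(\<lambda>z. indicator E z *\<^sub>R (k x z * (f z - f x))) = (\<lambda>z. \<Sum>i<m. indicator (E \<inter> P i) z *\<^sub>R (k x z * (f z - f x)))"
        by (simp only: cuts U)
      then show ?thesis
        by (simp only:) (rule Bochner_Integration.integral_sum, rule local_integrable[OF x EP])
    qed
    show "defect E x = (\<Sum>i<m. defect (E \<inter> P i) x)"
      unfolding defect_def 3 using 1 2 unfolding cuts U by (simp add: sum_subtractf sum_distrib_left)
  qed
qed

text \<open>Cut \<open>E\<close> into pieces of diameter \<open>O(\<delta>)\<close> with null boundaries. The defect of each piece is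
  supported on the piece, so the \<open>L\<^sup>1\<close> bounds of \<open>defect_small\<close> add up to \<open>O(\<delta>\<^sup>\<alpha>)\<close>.\<close>

lemma defect_zero:
  assumes E: "E \<in> sets borel" "bounded E"
  shows "AE x in \<mu>. defect E x = 0"
proof (cases "E = {}")
  case True
  then show ?thesis using defect_off[OF E] by simp
next
  case False
  define \<kappa> where "\<kappa> = (N + 1 + M * near_const \<alpha>) * L"
  have kap: "0 < \<kappa>" unfolding \<kappa>_def using N_pos M_pos L_pos near_const(1)[OF alpha(1)]
    by (intro mult_pos_pos add_pos_nonneg) auto
  obtain Rb where Rb: "closure E \<subseteq> ball 0 Rb" using bounded_subset_ballD[OF bounded_closure[OF E(2)], of 0] by blast
  \<comment> \<open>For \<delta> at most 1 every piece lies in this ball, so the total mass is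
    bounded independently of \<delta>.\<close>
  define V where "V = measure \<mu> (ball 0 (Rb + 1))"
  have V: "emeasure \<mu> (ball 0 (Rb + 1)) = ennreal V" "0 \<le> V"
    unfolding V_def using finite_ball[of 0 "Rb+1"] by (auto simp: emeasure_eq_ennreal_measure)
  have bound: "(\<integral>\<^sup>+x. ennreal (norm (defect E x)) \<partial>\<mu>) \<le> ennreal (\<kappa> * (2 * \<delta>) powr \<alpha> * V)"
    if \<delta>: "0 < \<delta>" "\<delta> \<le> 1" for \<delta>
  proof -
    obtain P :: "nat \<Rightarrow> 'a set" and m where P: "\<And>i. P i \<in> sets borel" "disjoint_family P" "E \<subseteq> (\<Union>i<m. P i)"
      "\<And>i. \<exists>q\<in>closure E. P i \<subseteq> ball q \<delta>" "\<And>i. AE x in \<mu>. x \<notin> P i \<longrightarrow> x \<notin> closure (P i)"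
      using small_partition[OF \<delta>(1) E(2) False] by blast
    have EP: "E \<inter> P i \<in> sets borel" "bounded (E \<inter> P i)" for i using E P by (auto intro: bounded_subset)
    have [measurable]: "defect (E \<inter> P i) \<in> borel_measurable \<mu>" for i by (rule defect_measurable[OF EP])
    have "(\<integral>\<^sup>+x. ennreal (norm (defect E x)) \<partial>\<mu>) \<le> (\<integral>\<^sup>+x. (\<Sum>i<m. ennreal (norm (defect (E \<inter> P i) x))) \<partial>\<mu>)"
    proof (rule nn_integral_mono_AE, rule eventually_mono[OF defect_decompose[OF E P(1-3)]])
      fix x assume "defect E x = (\<Sum>i<m. defect (E \<inter> P i) x)"
      then have "norm (defect E x) \<le> (\<Sum>i<m. norm (defect (E \<inter> P i) x))" using norm_sum by metis
      then show "ennreal (norm (defect E x)) \<le> (\<Sum>i<m. ennreal (norm (defect (E \<inter> P i) x)))"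
        by (simp add: ennreal_leI)
    qed
    also have "\<dots> = (\<Sum>i<m. \<integral>\<^sup>+x. ennreal (norm (defect (E \<inter> P i) x)) \<partial>\<mu>)"
      by (rule nn_integral_sum) measurable
    also have "\<dots> \<le> (\<Sum>i<m. ennreal (\<kappa> * (2 * \<delta>) powr \<alpha>) * emeasure \<mu> (P i))"
    proof (rule sum_mono)
      fix i
      obtain q where q: "P i \<subseteq> ball q \<delta>" using P(4) by blast
      have "AE x in \<mu>. ennreal (norm (defect (E \<inter> P i) x)) = ennreal (norm (defect (E \<inter> P i) x)) * indicator (P i) x"
        using defect_off[OF EP[of i]] P(5)[of i]
      proof eventually_elim
        fix x assume "x \<notin> closure (E \<inter> P i) \<longrightarrow> defect (E \<inter> P i) x = 0" "x \<notin> P i \<longrightarrow> x \<notin> closure (P i)"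
        moreover have "closure (E \<inter> P i) \<subseteq> closure (P i)" by (rule closure_mono) auto
        ultimately show "ennreal (norm (defect (E \<inter> P i) x)) = ennreal (norm (defect (E \<inter> P i) x)) * indicator (P i) x"
          by (cases "x \<in> P i") auto
      qed
      then have "(\<integral>\<^sup>+x. ennreal (norm (defect (E \<inter> P i) x)) \<partial>\<mu>) = (\<integral>\<^sup>+x. ennreal (norm (defect (E \<inter> P i) x)) * indicator (P i) x \<partial>\<mu>)"
        by (rule nn_integral_cong_AE)
      also have "\<dots> \<le> ennreal ((N + 1 + M * near_const \<alpha>) * (L * (2 * \<delta>) powr \<alpha>)) * emeasure \<mu> (P i)"
        by (rule defect_small[OF P(1) q \<delta>(1) EP(1)]) auto
      finally show "(\<integral>\<^sup>+x. ennreal (norm (defect (E \<inter> P i) x)) \<partial>\<mu>) \<le> ennreal (\<kappa> * (2 * \<delta>) powr \<alpha>) * emeasure \<mu> (P i)"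
        by (simp add: \<kappa>_def mult.assoc)
    qed
    also have "\<dots> = ennreal (\<kappa> * (2 * \<delta>) powr \<alpha>) * (\<Sum>i<m. emeasure \<mu> (P i))"
      by (simp add: sum_distrib_left)
    also have "(\<Sum>i<m. emeasure \<mu> (P i)) = emeasure \<mu> (\<Union>i<m. P i)"
      by (rule sum_emeasure) (use P(1,2) in \<open>auto simp: sets_mu disjoint_family_on_def\<close>)
    also have "\<dots> \<le> ennreal V"
      unfolding V(1)[symmetric]
    proof (rule emeasure_mono)
      show "(\<Union>i<m. P i) \<subseteq> ball 0 (Rb + 1)"
      proof
        fix x assume "x \<in> (\<Union>i<m. P i)"
        then obtain q where "q \<in> closure E" "x \<in> ball q \<delta>" using P(4) by blast
        then have "dist 0 q < Rb" "dist q x < 1" using Rb \<delta> by auto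
        then show "x \<in> ball 0 (Rb + 1)" using dist_triangle[of 0 x q] by (simp only: mem_ball)
      qed
    qed simp
    finally show ?thesis using V kap by (simp add: ennreal_mult mult_left_mono)
  qed
  have "(\<integral>\<^sup>+x. ennreal (norm (defect E x)) \<partial>\<mu>) \<le> 0"
  proof (rule ennreal_le_epsilon)
    fix e :: real assume e: "0 < e"
    \<comment> \<open>Adding 1 keeps the divisor positive when \<open>V = 0\<close>.\<close>
    define K where "K = \<kappa> * V + 1"
    have K: "0 < K" using kap V by (simp add: K_def add_nonneg_pos)
    define \<delta> where "\<delta> = min 1 ((e / K) powr (1 / \<alpha>) / 2)"
    have \<delta>: "0 < \<delta>" "\<delta> \<le> 1" "2 * \<delta> \<le> (e / K) powr (1 / \<alpha>)" using e K by (auto simp: \<delta>_def)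
    have "(2 * \<delta>) powr \<alpha> \<le> ((e / K) powr (1 / \<alpha>)) powr \<alpha>"
      by (rule powr_mono2) (use \<delta> alpha in auto)
    also have "\<dots> = e / K" using alpha e K by (simp add: powr_powr)
    finally have "K * (2 * \<delta>) powr \<alpha> \<le> e" using K by (simp add: field_simps)
    moreover have "\<kappa> * (2 * \<delta>) powr \<alpha> * V \<le> K * (2 * \<delta>) powr \<alpha>" unfolding K_def by (simp add: algebra_simps)
    ultimately show "(\<integral>\<^sup>+x. ennreal (norm (defect E x)) \<partial>\<mu>) \<le> 0 + ennreal e"
      using bound[OF \<delta>(1,2)] by (simp add: order_trans ennreal_leI)
  qed
  then have "(\<integral>\<^sup>+x. ennreal (norm (defect E x)) \<partial>\<mu>) = 0" by simp
  then have "AE x in \<mu>. ennreal (norm (defect E x)) = 0"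
    using defect_measurable[OF E] by (subst (asm) nn_integral_0_iff_AE) auto
  then show ?thesis by simp
qed

end

subsection \<open>The extension to Lipschitz functions\<close>

locale cz_T1_lip = cz_T1 \<mu> n A k T \<epsilon> M N c + cz_lip \<mu> n A k T \<epsilon> M N f G \<alpha> L
  for \<mu> :: "'a::euclidean_space measure" and n A
    and k :: "'a \<Rightarrow> 'a \<Rightarrow> 'k::{real_normed_field, banach, second_countable_topology}"
    and T \<epsilon> M N c f G \<alpha> L
begin

definition Psi :: "'a \<Rightarrow> real \<Rightarrow> 'a \<Rightarrow> 'k" where
  "Psi p r x = (\<integral>z. (k x z - W p r z) * (f z - f x) \<partial>\<mu>)"

definition TB :: "'a \<Rightarrow> real \<Rightarrow> 'a \<Rightarrow> 'k" where
  "TB p r x = T (cut (ball p (2 * r)) f) x + (\<integral>z. indicator (- ball p (2 * r)) z *\<^sub>R ((k x z - k p z) * f z) \<partial>\<mu>)"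

lemma Psi_split:
  "(k x z - W p r z) * (f z - f x) = indicator (ball p (2 * r)) z *\<^sub>R (k x z * (f z - f x))
     + indicator (- ball p (2 * r)) z *\<^sub>R ((k x z - k p z) * (f z - f x))"
  by (cases "z \<in> ball p (2 * r)") (auto simp: W_def)

text \<open>\<open>x\<close> may lie outside \<open>ball p r\<close>: integrability is shown for a
  ball large enough to contain \<open>x\<close> and transferred by \<open>W_diff_integrable\<close>.
  Thus one ball serves all points of \<open>G\<close>.\<close>

lemma Psi_integrable:
  assumes x: "x \<in> G" and r: "0 < r"
  shows "integrable \<mu> (\<lambda>z. (k x z - W p r z) * (f z - f x))"
proof -
  define R where "R = dist p x + 1"
  have R: "0 < R" "dist p x \<le> R" unfolding R_def using zero_le_dist[of p x] by linarith+
  have 1: "integrable \<mu> (\<lambda>z. indicator (ball p (2 * R)) z *\<^sub>R (k x z * (f z - f x)))"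
    by (rule local_integrable[OF x]) auto
  have 2: "integrable \<mu> (\<lambda>z. indicator (- ball p (2 * R)) z *\<^sub>R ((k x z - k p z) * (f z - f x)))"
    by (rule far_grows[OF f_minus_grows[OF x]]) (use alpha R in auto)
  have 3: "integrable \<mu> (\<lambda>z. (W p R z - W p r z) * (f z - f x))"
    by (rule W_diff_integrable[OF f_minus_grows[OF x]]) (use alpha R r in auto)
  have "integrable \<mu> (\<lambda>z. (k x z - W p R z) * (f z - f x) + (W p R z - W p r z) * (f z - f x))"
    unfolding Psi_split[of x _ p R] by (intro Bochner_Integration.integrable_add 1 2 3)
  then show ?thesis by (simp add: algebra_simps)
qed

text \<open>The 3 comes from the inclusion of 2B in \<open>ball x (3 * r)\<close>, the 2 from |x -
  z| \<le> 2 |p - z| outside 2B.\<close>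

lemma Psi_bound:
  assumes x: "x \<in> G" "x \<in> ball p r" and r: "0 < r"
  shows "norm (Psi p r x) \<le> M * (3 powr \<alpha> * near_const \<alpha> + 2 powr \<alpha> * far_const (\<epsilon> - \<alpha>)) * L * r powr \<alpha>"
proof -
  have m: "(\<lambda>z. f z - f x) \<in> borel_measurable \<mu>" by measurable
  have L0: "0 \<le> L" "0 \<le> L * 2 powr \<alpha>" using L_pos by auto
  have xr: "dist p x < r" using x by simp
  have sub: "ball p (2 * r) \<subseteq> ball x (3 * r)"
  proof
    fix z assume "z \<in> ball p (2 * r)"
    then show "z \<in> ball x (3 * r)" using xr dist_triangle3[of x z p] by simp
  qed
  have B: "ball p (2 * r) \<in> sets borel" "0 < 3 * r" using r by auto
  have far: "AE z in \<mu>. z \<notin> ball p (2 * r) \<longrightarrow> norm (f z - f x) \<le> L * 2 powr \<alpha> * dist p z powr \<alpha>"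
    using f_minus_bound[OF x(1)]
  proof (rule eventually_mono, intro impI)
    fix z assume *: "norm (f z - f x) \<le> L * dist x z powr \<alpha>" "z \<notin> ball p (2 * r)"
    have "dist x z powr \<alpha> \<le> (2 * dist p z) powr \<alpha>"
      by (rule powr_mono2) (use * xr r alpha dist_triangle3[of x z p] in auto)
    also have "\<dots> = 2 powr \<alpha> * dist p z powr \<alpha>" by (simp add: powr_mult)
    finally have "L * dist x z powr \<alpha> \<le> L * (2 powr \<alpha> * dist p z powr \<alpha>)" using L0(1) by (rule mult_left_mono)
    then show "norm (f z - f x) \<le> L * 2 powr \<alpha> * dist p z powr \<alpha>" using * by (simp add: mult.assoc)
  qed
  note n1 = near_kernel_integrable[OF m B(1) sub B(2) alpha(1) L0(1) f_minus_bound[OF x(1)]]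
  note n2 = far_kernel_integrable[OF m r less_imp_le[OF xr] alpha(2) L0(2) far]
  have "Psi p r x = (\<integral>z. indicator (ball p (2 * r)) z *\<^sub>R (k x z * (f z - f x)) \<partial>\<mu>)
     + (\<integral>z. indicator (- ball p (2 * r)) z *\<^sub>R ((k x z - k p z) * (f z - f x)) \<partial>\<mu>)"
    unfolding Psi_def Psi_split by (rule Bochner_Integration.integral_add[OF n1(1) n2(1)])
  then have "norm (Psi p r x) \<le> M * L * near_const \<alpha> * (3 * r) powr \<alpha> + M * (L * 2 powr \<alpha>) * far_const (\<epsilon> - \<alpha>) * r powr \<alpha>"
    using norm_triangle_le[OF add_mono[OF n1(2) n2(2)]] by simp
  also have "(3 * r) powr \<alpha> = 3 powr \<alpha> * r powr \<alpha>" using r by (simp add: powr_mult)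
  finally show ?thesis by (simp add: algebra_simps)
qed

text \<open>Inside 2B the vanishing defect exchanges T of the truncated \<open>f\<close> for f(x)
  times T of the indicator plus an integral; outside, f(z) is split as (f(z) - f(x)) + f(x). The two
  multiples of f(x) add up to \<open>T1 p r x = c p r\<close>.\<close>

lemma TB_formula:
  assumes p: "p \<in> msupport \<mu>" and r: "0 < r"
  shows "AE x in \<mu>. x \<in> ball p r \<longrightarrow> TB p r x = c p r * f x + Psi p r x"
proof -
  have B: "ball p (2 * r) \<in> sets borel" "bounded (ball p (2 * r))" by auto
  show ?thesis
    using defect_zero[OF B] T1_const[OF p r] G_AE
  proof (eventually_elim, intro impI)
    fix x assume d: "defect (ball p (2 * r)) x = 0" and c: "x \<in> ball p r \<longrightarrow> T1 p r x = c p r"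
      and xG: "x \<in> G" and x: "x \<in> ball p r"
    have xr: "dist p x \<le> r" using x by simp
    have g1: "grows 0 (\<lambda>_. 1::'k)" by (rule grows_const) simp
    have i0: "integrable \<mu> (\<lambda>z. indicator (ball p (2 * r)) z *\<^sub>R (k x z * (f z - f x)))"
      by (rule local_integrable[OF xG B])
    have i1: "integrable \<mu> (\<lambda>z. indicator (- ball p (2 * r)) z *\<^sub>R ((k x z - k p z) * (f z - f x)))"
      by (rule far_grows[OF f_minus_grows[OF xG] _ alpha(2) r xr]) (use alpha in simp)
    have i2: "integrable \<mu> (\<lambda>z. indicator (- ball p (2 * r)) z *\<^sub>R ((k x z - k p z) * 1))"
      by (rule far_grows[OF g1 _ eps_pos r xr]) simp
    have "(\<integral>z. indicator (- ball p (2 * r)) z *\<^sub>R ((k x z - k p z) * f z) \<partial>\<mu>)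
       = (\<integral>z. (indicator (- ball p (2 * r)) z *\<^sub>R ((k x z - k p z) * (f z - f x))
          + f x * (indicator (- ball p (2 * r)) z *\<^sub>R ((k x z - k p z) * 1))) \<partial>\<mu>)"
      by (rule Bochner_Integration.integral_cong) (auto simp: algebra_simps split: split_indicator)
    also have "\<dots> = (\<integral>z. indicator (- ball p (2 * r)) z *\<^sub>R ((k x z - k p z) * (f z - f x)) \<partial>\<mu>)
        + (\<integral>z. f x * (indicator (- ball p (2 * r)) z *\<^sub>R ((k x z - k p z) * 1)) \<partial>\<mu>)"
      by (intro Bochner_Integration.integral_add i1 integrable_mult_right i2)
    also have "(\<integral>z. f x * (indicator (- ball p (2 * r)) z *\<^sub>R ((k x z - k p z) * 1)) \<partial>\<mu>)
        = f x * (\<integral>z. indicator (- ball p (2 * r)) z *\<^sub>R ((k x z - k p z) * 1) \<partial>\<mu>)"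
      by (rule integral_mult_right_zero)
    finally have tail: "(\<integral>z. indicator (- ball p (2 * r)) z *\<^sub>R ((k x z - k p z) * f z) \<partial>\<mu>)
       = (\<integral>z. indicator (- ball p (2 * r)) z *\<^sub>R ((k x z - k p z) * (f z - f x)) \<partial>\<mu>)
        + f x * (\<integral>z. indicator (- ball p (2 * r)) z *\<^sub>R (k x z - k p z) \<partial>\<mu>)" by simp
    have P: "Psi p r x = (\<integral>z. indicator (ball p (2 * r)) z *\<^sub>R (k x z * (f z - f x)) \<partial>\<mu>)
       + (\<integral>z. indicator (- ball p (2 * r)) z *\<^sub>R ((k x z - k p z) * (f z - f x)) \<partial>\<mu>)"
      unfolding Psi_def Psi_split by (rule Bochner_Integration.integral_add[OF i0 i1])
    have c': "c p r = T (cut (ball p (2 * r)) (\<lambda>_. 1)) x + (\<integral>z. indicator (- ball p (2 * r)) z *\<^sub>R (k x z - k p z) \<partial>\<mu>)"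
      using c x unfolding T1_def by simp
    show "TB p r x = c p r * f x + Psi p r x"
      unfolding TB_def tail P c' using d unfolding defect_def by (simp add: algebra_simps)
  qed
qed

text \<open>In the difference of the two \<open>Psi\<close> terms \<open>k x z\<close> cancels, and
  \<open>c_diff\<close> absorbs the remaining multiple of f(x). The right side is free of
  \<open>x\<close>, and \<open>x\<close> ranges over all of \<open>G\<close>.\<close>

lemma ball_change:
  assumes x: "x \<in> G" and "p \<in> msupport \<mu>" "q \<in> msupport \<mu>" "0 < r" "0 < s"
  shows "c q s * f x + Psi q s x - (c p r * f x + Psi p r x) = (\<integral>z. (W p r z - W q s z) * f z \<partial>\<mu>)"
proof -
  have i1: "integrable \<mu> (\<lambda>z. (W p r z - W q s z) * f z)"
    by (rule W_diff_integrable[OF f_grows]) (use alpha assms in auto)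
  have i2: "integrable \<mu> (\<lambda>z. W p r z - W q s z)" by (rule W_diff_integrable1) (use assms in auto)
  have "Psi q s x - Psi p r x = (\<integral>z. ((k x z - W q s z) * (f z - f x) - (k x z - W p r z) * (f z - f x)) \<partial>\<mu>)"
    unfolding Psi_def by (rule Bochner_Integration.integral_diff[symmetric]; rule Psi_integrable[OF x]) (use assms in auto)
  also have "\<dots> = (\<integral>z. ((W p r z - W q s z) * f z - f x * (W p r z - W q s z)) \<partial>\<mu>)"
    by (rule Bochner_Integration.integral_cong) (auto simp: algebra_simps)
  also have "\<dots> = (\<integral>z. (W p r z - W q s z) * f z \<partial>\<mu>) - (\<integral>z. f x * (W p r z - W q s z) \<partial>\<mu>)"
    by (intro Bochner_Integration.integral_diff i1 integrable_mult_right i2)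
  also have "(\<integral>z. f x * (W p r z - W q s z) \<partial>\<mu>) = f x * (c q s - c p r)"
    unfolding c_diff[OF assms(2-5)] by (rule integral_mult_right_zero)
  finally show ?thesis by (simp add: algebra_simps)
qed

lemma Psi_measurable: "Psi p r \<in> borel_measurable \<mu>"
proof -
  interpret sigma_finite_measure \<mu> by (rule sigma_finite)
  show ?thesis unfolding Psi_def by measurable
qed

text \<open>By \<open>ball_change\<close> the increment can be computed in \<open>ball x s\<close>
  with s = 2 |x - y|, which contains both points. There it is c (f(x) - f(y)) plus a difference of
  two \<open>Psi\<close> terms, each O(s^\<alpha>).\<close>

lemma Psi_lipschitz:
  assumes C0: "\<And>p r. p \<in> msupport \<mu> \<Longrightarrow> 0 < r \<Longrightarrow> norm (c p r) \<le> C0"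
    and x: "x \<in> G" and y: "y \<in> G" and p: "p \<in> msupport \<mu>" "0 < r"
  shows "norm (c p r * f x + Psi p r x - (c p r * f y + Psi p r y))
    \<le> (C0 + 2 * (M * (3 powr \<alpha> * near_const \<alpha> + 2 powr \<alpha> * far_const (\<epsilon> - \<alpha>))) * 2 powr \<alpha>) * L * dist x y powr \<alpha>"
proof (cases "x = y")
  case False
  define s where "s = 2 * dist x y"
  define H where "H = M * (3 powr \<alpha> * near_const \<alpha> + 2 powr \<alpha> * far_const (\<epsilon> - \<alpha>))"
  have s: "0 < s" "x \<in> ball x s" "y \<in> ball x s" using False by (auto simp: s_def)
  have xs: "x \<in> msupport \<mu>" using x G_supp by auto
  define I where "I = (\<integral>z. (W p r z - W x s z) * f z \<partial>\<mu>)"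
  have ex: "c p r * f x + Psi p r x = c x s * f x + Psi x s x - I"
    using ball_change[OF x p(1) xs p(2) s(1)] unfolding I_def by (simp add: algebra_simps)
  have ey: "c p r * f y + Psi p r y = c x s * f y + Psi x s y - I"
    using ball_change[OF y p(1) xs p(2) s(1)] unfolding I_def by (simp add: algebra_simps)
  have eq: "c p r * f x + Psi p r x - (c p r * f y + Psi p r y) = c x s * (f x - f y) + (Psi x s x - Psi x s y)"
    unfolding ex ey by (simp add: algebra_simps)
  have "norm (c p r * f x + Psi p r x - (c p r * f y + Psi p r y))
      \<le> norm (c x s) * norm (f x - f y) + (norm (Psi x s x) + norm (Psi x s y))"
    unfolding eq using norm_triangle_ineq[of "c x s * (f x - f y)" "Psi x s x - Psi x s y"] norm_triangle_ineq4[of "Psi x s x" "Psi x s y"]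
    unfolding norm_mult by linarith
  also have "\<dots> \<le> C0 * (L * dist x y powr \<alpha>) + (H * L * s powr \<alpha> + H * L * s powr \<alpha>)"
    unfolding H_def
    by (intro add_mono mult_mono C0 f_lip Psi_bound x y s xs) (use order_trans[OF norm_ge_zero C0[OF xs s(1)]] in auto)
  also have "s powr \<alpha> = 2 powr \<alpha> * dist x y powr \<alpha>" unfolding s_def by (simp add: powr_mult)
  finally show ?thesis unfolding H_def[symmetric] by (simp add: algebra_simps)
qed simp

end

subsection \<open>Lipschitz classes\<close>

lemma lip_boundE:
  assumes "lip_bound \<alpha> \<mu> f C"
  obtains N where "N \<in> null_sets \<mu>"
    "\<And>x y. x \<in> msupport \<mu> - N \<Longrightarrow> y \<in> msupport \<mu> - N \<Longrightarrow> norm (f x - f y) \<le> C * dist x y powr \<alpha>"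
  using assms unfolding lip_bound_def by blast

lemma lip_bound_cong:
  fixes \<mu> :: "'a::euclidean_space measure"
  assumes s: "sets \<mu> = sets borel" and ae: "AE x in \<mu>. h x = f x + a" and "lip_bound \<alpha> \<mu> h C"
  shows "lip_bound \<alpha> \<mu> f C"
proof -
  obtain N where N: "N \<in> null_sets \<mu>"
    "\<And>x y. x \<in> msupport \<mu> - N \<Longrightarrow> y \<in> msupport \<mu> - N \<Longrightarrow> norm (h x - h y) \<le> C * dist x y powr \<alpha>"
    using lip_boundE[OF assms(3)] by blast
  have sp: "space \<mu> = UNIV" using sets_eq_imp_space_eq[OF s] by simp
  obtain N' where N': "{x \<in> space \<mu>. h x \<noteq> f x + a} \<subseteq> N'" "N' \<in> null_sets \<mu>"
    using ae by (auto elim!: AE_E simp: null_sets_def)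
  show ?thesis unfolding lip_bound_def
  proof (intro bexI ballI)
    fix x y assume x: "x \<in> msupport \<mu> - (N \<union> N')" and y: "y \<in> msupport \<mu> - (N \<union> N')"
    then have "h x = f x + a" "h y = f y + a" using N'(1) sp by auto
    then show "norm (f x - f y) \<le> C * dist x y powr \<alpha>" using N(2)[of x y] x y by auto
  qed (use N N' in auto)
qed

lemma mod_const_self: "f \<in> borel_measurable \<mu> \<Longrightarrow> f \<in> mod_const \<mu> f"
  unfolding mod_const_def by (auto intro: exI[of _ 0])

lemma mod_const_cong:
  assumes "AE x in \<mu>. g x = f x + a"
  shows "mod_const \<mu> g = mod_const \<mu> f"
proof -
  have "(\<exists>c. AE x in \<mu>. h x = g x + c) \<longleftrightarrow> (\<exists>c. AE x in \<mu>. h x = f x + c)" for h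
  proof
    assume "\<exists>c. AE x in \<mu>. h x = g x + c"
    then obtain c where "AE x in \<mu>. h x = g x + c" by blast
    with assms have "AE x in \<mu>. h x = f x + (a + c)" by eventually_elim simp
    then show "\<exists>c. AE x in \<mu>. h x = f x + c" by blast
  next
    assume "\<exists>c. AE x in \<mu>. h x = f x + c"
    then obtain c where "AE x in \<mu>. h x = f x + c" by blast
    with assms have "AE x in \<mu>. h x = g x + (c - a)" by eventually_elim simp
    then show "\<exists>c. AE x in \<mu>. h x = g x + c" by blast
  qed
  then show ?thesis unfolding mod_const_def by simp
qed

lemma lip_norm_mod_const:
  fixes \<mu> :: "'a::euclidean_space measure"
  assumes s: "sets \<mu> = sets borel" and f: "f \<in> borel_measurable \<mu>"
  shows "lip_norm \<alpha> \<mu> (mod_const \<mu> f) = Inf {C. 0 \<le> C \<and> lip_bound \<alpha> \<mu> f C}"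
proof -
  have "(\<exists>g\<in>mod_const \<mu> f. lip_bound \<alpha> \<mu> g C) \<longleftrightarrow> lip_bound \<alpha> \<mu> f C" for C
    using lip_bound_cong[OF s] mod_const_self[OF f] unfolding mod_const_def by blast
  then show ?thesis unfolding lip_norm_def by simp
qed

lemma lip_norm_mod_const_le:
  fixes \<mu> :: "'a::euclidean_space measure"
  assumes "sets \<mu> = sets borel" "f \<in> borel_measurable \<mu>" "0 \<le> C" "lip_bound \<alpha> \<mu> f C"
  shows "lip_norm \<alpha> \<mu> (mod_const \<mu> f) \<le> C"
  unfolding lip_norm_mod_const[OF assms(1,2)]
  by (rule cInf_lower) (use assms in \<open>auto intro: bdd_belowI[of _ 0]\<close>)

text \<open>The exceptional null set depends on the admissible constant. The constants 1/(m+1) give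
  countably many null sets, and off their union \<open>g\<close> has oscillation 0.\<close>

lemma lip_norm_le_0_imp_const:
  fixes \<mu> :: "'a::euclidean_space measure" and g :: "'a \<Rightarrow> 'k::{banach, second_countable_topology}"
  assumes s: "sets \<mu> = sets borel" and g: "g \<in> borel_measurable \<mu>" "0 \<le> C0" "lip_bound \<alpha> \<mu> g C0"
    and le: "lip_norm \<alpha> \<mu> (mod_const \<mu> g) \<le> 0"
  shows "mod_const \<mu> g = mod_const \<mu> (\<lambda>_. 0)"
proof -
  define S where "S = {C. 0 \<le> C \<and> lip_bound \<alpha> \<mu> g C}"
  have S: "S \<noteq> {}" "Inf S \<le> 0" using g le unfolding lip_norm_mod_const[OF s g(1)] S_def by auto
  have "\<exists>N\<in>null_sets \<mu>. \<forall>x\<in>msupport \<mu> - N. \<forall>y\<in>msupport \<mu> - N. norm (g x - g y) \<le> 1 / real (Suc m) * dist x y powr \<alpha>" for m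
  proof -
    have "Inf S < 1 / real (Suc m)" using S(2) by (smt (verit) of_nat_0_less_iff zero_less_Suc zero_less_divide_1_iff)
    then obtain C where C: "C \<in> S" "C < 1 / real (Suc m)" using cInf_lessD[OF S(1)] by blast
    then obtain N where N: "N \<in> null_sets \<mu>"
      "\<And>x y. x \<in> msupport \<mu> - N \<Longrightarrow> y \<in> msupport \<mu> - N \<Longrightarrow> norm (g x - g y) \<le> C * dist x y powr \<alpha>"
      unfolding S_def lip_bound_def by blast
    have "C * dist x y powr \<alpha> \<le> 1 / real (Suc m) * dist x y powr \<alpha>" for x y :: 'a
      using C(2) by (intro mult_right_mono) auto
    then show ?thesis using N by (meson order_trans)
  qed
  then obtain N where N: "\<And>m. N m \<in> null_sets \<mu>"
    "\<And>m x y. x \<in> msupport \<mu> - N m \<Longrightarrow> y \<in> msupport \<mu> - N m \<Longrightarrow> norm (g x - g y) \<le> 1 / real (Suc m) * dist x y powr \<alpha>"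
    by metis
  have "AE x in \<mu>. x \<notin> (\<Union>m. N m)" by (rule AE_not_in) (use N(1) in auto)
  then have ae: "AE x in \<mu>. x \<in> msupport \<mu> - (\<Union>m. N m)"
    using msupport_compl_null[OF s] by eventually_elim auto
  have eq: "g x = g y" if "x \<in> msupport \<mu> - (\<Union>m. N m)" "y \<in> msupport \<mu> - (\<Union>m. N m)" for x y
  proof -
    have "norm (g x - g y) \<le> 0 + e" if e: "0 < e" for e
    proof -
      obtain m where m: "dist x y powr \<alpha> / e < real m" using reals_Archimedean2 by blast
      have "norm (g x - g y) \<le> 1 / real (Suc m) * dist x y powr \<alpha>"
        using N(2)[of x m y] \<open>x \<in> _\<close> \<open>y \<in> _\<close> by blast
      also have "\<dots> \<le> e" using m e by (simp add: field_simps)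
      finally show ?thesis by simp
    qed
    then have "norm (g x - g y) \<le> 0" by (rule field_le_epsilon)
    then show ?thesis by simp
  qed
  have "\<exists>a. AE x in \<mu>. g x = 0 + a"
  proof (cases "msupport \<mu> - (\<Union>m. N m) = {}")
    case True
    then have "AE x in \<mu>. g x = 0 + 0" by (intro eventually_mono[OF ae]) blast
    then show ?thesis by blast
  next
    case False
    then obtain y where y: "y \<in> msupport \<mu> - (\<Union>m. N m)" by blast
    have "AE x in \<mu>. g x = 0 + g y"
      using ae by (rule eventually_mono) (simp only: eq[OF _ y] add_0)
    then show ?thesis by blast
  qed
  then obtain a where "AE x in \<mu>. g x = 0 + a" by blast
  then show ?thesis by (rule mod_const_cong)
qed

text \<open>Local integrability is automatic: the Lipschitz bound makes \<open>g\<close> a.e.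
  bounded on compact sets, which have finite measure.\<close>

lemma (in growth_measure) lip_bound_in_lip_functions:
  fixes g :: "'a \<Rightarrow> 'k::{banach, second_countable_topology}"
  assumes g: "g \<in> borel_measurable \<mu>" and "0 \<le> C" "0 \<le> \<alpha>" and lip: "lip_bound \<alpha> \<mu> g C"
  shows "g \<in> lip_functions \<alpha> \<mu>"
proof -
  obtain N where N: "N \<in> null_sets \<mu>"
    "\<And>x y. x \<in> msupport \<mu> - N \<Longrightarrow> y \<in> msupport \<mu> - N \<Longrightarrow> norm (g x - g y) \<le> C * dist x y powr \<alpha>"
    using lip_boundE[OF lip] by blast
  have G: "AE x in \<mu>. x \<in> msupport \<mu> - N"
    using msupport_compl_null[OF sets_mu] AE_not_in[OF N(1)] by eventually_elim auto
  have gr: "grows \<alpha> g" by (rule lip_grows[OF g G assms(2,3) N(2)])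
  have "set_integrable \<mu> S g" if S: "compact S" for S
  proof -
    have S': "S \<in> sets borel" "bounded S" using S by (auto intro: borel_compact compact_imp_bounded)
    obtain b where b: "0 \<le> b" "AE z in \<mu>. z \<in> S \<longrightarrow> norm (g z) \<le> b"
      using grows_bounded[OF gr assms(3) S'(2)] by blast
    have [measurable]: "S \<in> sets \<mu>" "g \<in> borel_measurable \<mu>" using S' g by (auto simp: sets_mu)
    show ?thesis unfolding set_integrable_def
    proof (rule integrable_dominated(1))
      show "integrable \<mu> (\<lambda>z. b * indicator S z)" using integrable_indicator_bounded[OF S'] by simp
      show "AE z in \<mu>. norm (indicator S z *\<^sub>R g z) \<le> b * indicator S z"
        using b(2) by (rule eventually_mono) (auto split: split_indicator)
    qed measurable
  qed
  then show ?thesis using assms(2) lip g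
    by (auto simp: lip_functions_def loc_integrable_on_def set_borel_measurable_def)
qed

text \<open>The integral runs over the complement of 2B, which contains neither \<open>x\<close> nor
  the centre.\<close>

lemma cz_ball_off_diagonal:
  fixes K K' :: "'a::euclidean_space \<Rightarrow> 'a \<Rightarrow> 'k::{real_normed_field, banach, second_countable_topology}"
  assumes eq: "\<And>x y. x \<noteq> y \<Longrightarrow> K x y = K' x y" and x: "x \<in> ball p r" "0 < r"
  shows "cz_ball \<mu> K T f p r x = cz_ball \<mu> K' T f p r x"
proof -
  have "(LINT z:UNIV - ball p (2 * r)|\<mu>. (K x z - K p z) * f z) = (LINT z:UNIV - ball p (2 * r)|\<mu>. (K' x z - K' p z) * f z)"
    unfolding set_lebesgue_integral_def
  proof (intro Bochner_Integration.integral_cong refl)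
    fix z
    show "indicator (UNIV - ball p (2 * r)) z *\<^sub>R ((K x z - K p z) * f z) = indicator (UNIV - ball p (2 * r)) z *\<^sub>R ((K' x z - K' p z) * f z)"
    proof (cases "z \<in> ball p (2 * r)")
      case False
      then have "x \<noteq> z" "p \<noteq> z" using x by auto
      then show ?thesis using eq by simp
    qed simp
  qed
  then show ?thesis unfolding cz_ball_def by simp
qed

lemma cz_ext_off_diagonal:
  fixes K K' :: "'a::euclidean_space \<Rightarrow> 'a \<Rightarrow> 'k::{real_normed_field, banach, second_countable_topology}"
  assumes "\<And>x y. x \<noteq> y \<Longrightarrow> K x y = K' x y"
  shows "cz_ext \<mu> K T f = cz_ext \<mu> K' T f"
proof -
  have "(x \<in> ball p r \<longrightarrow> g x = cz_ball \<mu> K T f p r x + c) \<longleftrightarrow> (x \<in> ball p r \<longrightarrow> g x = cz_ball \<mu> K' T f p r x + c)"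
    if "0 < r" for p r x c and g :: "'a \<Rightarrow> 'k"
    using cz_ball_off_diagonal[of K K' x p r \<mu> T f] assms that by auto
  then show ?thesis unfolding cz_ext_def by simp
qed

subsection \<open>The class \<open>T(f)\<close>\<close>

lemma (in cz_setup) cz_ball_one: "cz_ball \<mu> k T (\<lambda>_. 1) p r x = T1 p r x"
  unfolding cz_ball_def T1_def set_lebesgue_integral_def by (simp add: Compl_eq_Diff_UNIV)

context cz_T1_lip begin

lemma cz_ball_TB: "cz_ball \<mu> k T f p r x = TB p r x"
  unfolding cz_ball_def TB_def set_lebesgue_integral_def by (simp add: Compl_eq_Diff_UNIV)

text \<open>The \<open>SOME\<close> is junk only if the support is empty, that is \<open>\<mu> = 0\<close>.\<close>

definition rep :: "'a \<Rightarrow> 'k" where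
  "rep x = (let p = SOME p. p \<in> msupport \<mu> in c p 1 * f x + Psi p 1 x)"

lemma rep_measurable: "rep \<in> borel_measurable \<mu>"
proof -
  have [measurable]: "Psi p r \<in> borel_measurable \<mu>" for p r by (rule Psi_measurable)
  show ?thesis unfolding rep_def Let_def by measurable
qed

lemma rep_lip_bound:
  assumes C0: "\<And>p r. p \<in> msupport \<mu> \<Longrightarrow> 0 < r \<Longrightarrow> norm (c p r) \<le> C0"
  shows "lip_bound \<alpha> \<mu> rep
    ((C0 + 2 * (M * (3 powr \<alpha> * near_const \<alpha> + 2 powr \<alpha> * far_const (\<epsilon> - \<alpha>))) * 2 powr \<alpha>) * L)"
proof -
  obtain N where N: "{x \<in> space \<mu>. x \<notin> G} \<subseteq> N" "N \<in> null_sets \<mu>"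
    using G_AE by (auto elim!: AE_E simp: null_sets_def)
  show ?thesis unfolding lip_bound_def
  proof (rule bexI[OF _ N(2)], intro ballI)
    fix x y assume "x \<in> msupport \<mu> - N" "y \<in> msupport \<mu> - N"
    then have G: "x \<in> G" "y \<in> G" and m: "x \<in> msupport \<mu>" using N(1) by auto
    have p: "(SOME p. p \<in> msupport \<mu>) \<in> msupport \<mu>" by (rule someI[of "\<lambda>p. p \<in> msupport \<mu>", OF m])
    show "norm (rep x - rep y) \<le> (C0 + 2 * (M * (3 powr \<alpha> * near_const \<alpha> + 2 powr \<alpha> * far_const (\<epsilon> - \<alpha>))) * 2 powr \<alpha>) * L * dist x y powr \<alpha>"
      unfolding rep_def Let_def by (rule Psi_lipschitz[OF C0 G p]) auto
  qed
qed

lemma rep_in_cz_ext: "rep \<in> cz_ext \<mu> k T f"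
  unfolding cz_ext_def
proof (intro CollectI conjI rep_measurable ballI allI impI)
  fix q r assume q: "q \<in> msupport \<mu>" and r: "0 < (r::real)"
  define p where "p = (SOME p. p \<in> msupport \<mu>)"
  have p: "p \<in> msupport \<mu>" unfolding p_def by (rule someI[of "\<lambda>p. p \<in> msupport \<mu>", OF q])
  \<comment> \<open>The additive constant for \<open>ball q r\<close> is the integral in
    \<open>ball_change\<close>.\<close>
  have "AE x in \<mu>. x \<in> ball q r \<longrightarrow> rep x = cz_ball \<mu> k T f q r x + (\<integral>z. (W q r z - W p 1 z) * f z \<partial>\<mu>)"
    using TB_formula[OF q r] G_AE
  proof (eventually_elim, intro impI)
    fix x assume T: "x \<in> ball q r \<longrightarrow> TB q r x = c q r * f x + Psi q r x" and x: "x \<in> G" "x \<in> ball q r"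
    have "rep x = c p 1 * f x + Psi p 1 x" unfolding rep_def Let_def p_def by simp
    then show "rep x = cz_ball \<mu> k T f q r x + (\<integral>z. (W q r z - W p 1 z) * f z \<partial>\<mu>)"
      using ball_change[OF x(1) q p r, of 1] T x(2) unfolding cz_ball_TB by (simp add: algebra_simps)
  qed
  then show "\<exists>a. AE x in \<mu>. x \<in> ball q r \<longrightarrow> rep x = cz_ball \<mu> k T f q r x + a" by blast
qed

end

text \<open>Balls of integer radius about one support point exhaust the space. Their additive
  constants agree because all these balls contain \<open>ball p 1\<close>, which has positive
  measure.\<close>

lemma (in growth_measure) cz_ext_unique:
  fixes K :: "'a \<Rightarrow> 'a \<Rightarrow> 'k::{real_normed_field, banach, second_countable_topology}"
  assumes g: "g \<in> cz_ext \<mu> K T f" and h: "h \<in> cz_ext \<mu> K T f"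
  shows "\<exists>a. AE x in \<mu>. h x = g x + a"
proof (cases "msupport \<mu> = {}")
  case True
  then have "AE x in \<mu>. h x = g x + 0" by (intro eventually_mono[OF msupport_compl_null[OF sets_mu]]) blast
  then show ?thesis by blast
next
  case False
  then obtain p where p: "p \<in> msupport \<mu>" by blast
  have "\<exists>a. AE x in \<mu>. x \<in> ball p (real (Suc j)) \<longrightarrow> h x = g x + a" for j
  proof -
    have r: "0 < real (Suc j)" by simp
    obtain a where a: "AE x in \<mu>. x \<in> ball p (real (Suc j)) \<longrightarrow> g x = cz_ball \<mu> K T f p (real (Suc j)) x + a"
      using g p r unfolding cz_ext_def by blast
    obtain b where b: "AE x in \<mu>. x \<in> ball p (real (Suc j)) \<longrightarrow> h x = cz_ball \<mu> K T f p (real (Suc j)) x + b"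
      using h p r unfolding cz_ext_def by blast
    from a b have "AE x in \<mu>. x \<in> ball p (real (Suc j)) \<longrightarrow> h x = g x + (b - a)"
      by eventually_elim auto
    then show ?thesis by blast
  qed
  then obtain a where a: "\<And>j. AE x in \<mu>. x \<in> ball p (real (Suc j)) \<longrightarrow> h x = g x + a j" by metis
  have const: "a j = a 0" for j
  proof -
    have "AE x in \<mu>. x \<in> ball p 1 \<longrightarrow> a j = a 0"
      using a[of j] a[of 0] by eventually_elim auto
    then show ?thesis by (rule AE_ball_obtain[OF p zero_less_one])
  qed
  have "AE x in \<mu>. \<forall>j. x \<in> ball p (real (Suc j)) \<longrightarrow> h x = g x + a j"
    using a by (simp only: AE_all_countable) blast
  then have "AE x in \<mu>. h x = g x + a 0"
  proof (rule eventually_mono)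
    fix x assume *: "\<forall>j. x \<in> ball p (real (Suc j)) \<longrightarrow> h x = g x + a j"
    obtain j where "dist p x < real j" using reals_Archimedean2 by blast
    then have "x \<in> ball p (real (Suc j))" by simp
    then show "h x = g x + a 0" using * const by metis
  qed
  then show ?thesis by blast
qed

lemma (in growth_measure) cz_ext_eq_mod_const:
  fixes K :: "'a \<Rightarrow> 'a \<Rightarrow> 'k::{real_normed_field, banach, second_countable_topology}"
  assumes g: "g \<in> cz_ext \<mu> K T f"
  shows "cz_ext \<mu> K T f = mod_const \<mu> g"
proof (intro set_eqI iffI)
  fix h assume h: "h \<in> cz_ext \<mu> K T f"
  then show "h \<in> mod_const \<mu> g" using cz_ext_unique[OF g h] by (auto simp: mod_const_def cz_ext_def)
next
  fix h assume "h \<in> mod_const \<mu> g"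
  then obtain a where hm: "h \<in> borel_measurable \<mu>" and a: "AE x in \<mu>. h x = g x + a" by (auto simp: mod_const_def)
  show "h \<in> cz_ext \<mu> K T f" unfolding cz_ext_def
  proof (intro CollectI conjI hm ballI allI impI)
    fix p r assume "p \<in> msupport \<mu>" "0 < (r::real)"
    then obtain b where "AE x in \<mu>. x \<in> ball p r \<longrightarrow> g x = cz_ball \<mu> K T f p r x + b"
      using g unfolding cz_ext_def by blast
    with a have "AE x in \<mu>. x \<in> ball p r \<longrightarrow> h x = cz_ball \<mu> K T f p r x + (b + a)" by eventually_elim auto
    then show "\<exists>b. AE x in \<mu>. x \<in> ball p r \<longrightarrow> h x = cz_ball \<mu> K T f p r x + b" by blast
  qed
qed

section \<open>Boundedness from T(1) = 0\<close>

context cz_T1 begin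

lemma bounded_on_Lip:
  assumes alpha: "0 < \<alpha>" "\<alpha> < \<epsilon>"
  shows "bounded_on_Lip \<alpha> \<mu> k T"
proof -
  obtain C0 where C0: "0 \<le> C0" "\<And>p r. p \<in> msupport \<mu> \<Longrightarrow> 0 < r \<Longrightarrow> norm (c p r) \<le> C0"
    using c_bounded by blast
  define H where "H = C0 + 2 * (M * (3 powr \<alpha> * near_const \<alpha> + 2 powr \<alpha> * far_const (\<epsilon> - \<alpha>))) * 2 powr \<alpha>"
  have H: "0 \<le> H" unfolding H_def using C0(1) M_pos near_const(1)[OF alpha(1)] far_const(1)[of "\<epsilon> - \<alpha>"] alpha
    by (intro add_nonneg_nonneg mult_nonneg_nonneg) auto
  have main: "cz_ext \<mu> k T f \<in> Lip \<alpha> \<mu> \<and> lip_norm \<alpha> \<mu> (cz_ext \<mu> k T f) \<le> H * L"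
    if f: "f \<in> borel_measurable \<mu>" and L: "0 < L" and lip: "lip_bound \<alpha> \<mu> f L" for f L
  proof -
    obtain N0 where N0: "N0 \<in> null_sets \<mu>"
      "\<And>x y. x \<in> msupport \<mu> - N0 \<Longrightarrow> y \<in> msupport \<mu> - N0 \<Longrightarrow> norm (f x - f y) \<le> L * dist x y powr \<alpha>"
      using lip_boundE[OF lip] by blast
    have G: "AE x in \<mu>. x \<in> msupport \<mu> - N0"
      using msupport_compl_null[OF sets_mu] AE_not_in[OF N0(1)] by eventually_elim auto
    interpret F: cz_T1_lip \<mu> n A k T \<epsilon> M N c f "msupport \<mu> - N0" \<alpha> L
      by unfold_locales (rule alpha, rule alpha, rule G, blast, rule f, rule L, rule N0(2))
    have eq: "cz_ext \<mu> k T f = mod_const \<mu> F.rep" by (rule cz_ext_eq_mod_const[OF F.rep_in_cz_ext])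
    have lb: "lip_bound \<alpha> \<mu> F.rep (H * L)" unfolding H_def by (rule F.rep_lip_bound[OF C0(2)])
    have HL: "0 \<le> H * L" using H L by simp
    have "F.rep \<in> lip_functions \<alpha> \<mu>"
      by (rule lip_bound_in_lip_functions[OF F.rep_measurable HL _ lb]) (use alpha in simp)
    moreover have "lip_norm \<alpha> \<mu> (mod_const \<mu> F.rep) \<le> H * L"
      by (rule lip_norm_mod_const_le[OF sets_mu F.rep_measurable HL lb])
    ultimately show ?thesis unfolding eq Lip_def by blast
  qed
  show ?thesis unfolding bounded_on_Lip_def
  proof (intro exI[of _ H] ballI conjI)
    fix f :: "'a \<Rightarrow> 'k" assume "f \<in> lip_functions \<alpha> \<mu>"
    then obtain L0 where f: "f \<in> borel_measurable \<mu>" and L0: "0 \<le> L0" "lip_bound \<alpha> \<mu> f L0"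
      by (auto simp: lip_functions_def loc_integrable_on_def set_borel_measurable_def)
    have mono: "lip_bound \<alpha> \<mu> f L'" if L: "lip_bound \<alpha> \<mu> f L" "L \<le> L'" for L L'
    proof -
      obtain N0 where "N0 \<in> null_sets \<mu>"
        "\<And>x y. x \<in> msupport \<mu> - N0 \<Longrightarrow> y \<in> msupport \<mu> - N0 \<Longrightarrow> norm (f x - f y) \<le> L * dist x y powr \<alpha>"
        using lip_boundE[OF L(1)] by blast
      moreover have "L * dist x y powr \<alpha> \<le> L' * dist x y powr \<alpha>" for x y :: 'a
        using L(2) by (rule mult_right_mono) simp
      ultimately show ?thesis unfolding lip_bound_def by (meson order_trans)
    qed
    show "cz_ext \<mu> k T f \<in> Lip \<alpha> \<mu>"
      using main[OF f, of "L0 + 1"] mono[OF L0(2), of "L0 + 1"] L0(1) by simp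
    have bd: "lip_norm \<alpha> \<mu> (cz_ext \<mu> k T f) \<le> H * L" if L: "0 \<le> L" "lip_bound \<alpha> \<mu> f L" for L
    proof (cases "H = 0")
      case True
      then show ?thesis using main[OF f, of "L + 1"] mono[OF L(2), of "L + 1"] L(1) by simp
    next
      case False
      show ?thesis
      \<comment> \<open>An admissible \<open>L\<close> may be 0 while \<open>main\<close> needs a
        positive constant, so \<open>main\<close> is applied to \<open>L + e / H\<close>.\<close>
      proof (rule field_le_epsilon)
        fix e :: real assume e: "0 < e"
        then have "0 < e / H" using H False by simp
        then have "lip_norm \<alpha> \<mu> (cz_ext \<mu> k T f) \<le> H * (L + e / H)"
          using main[OF f, of "L + e / H"] mono[OF L(2), of "L + e / H"] L(1) by simp
        then show "lip_norm \<alpha> \<mu> (cz_ext \<mu> k T f) \<le> H * L + e" using False by (simp add: algebra_simps)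
      qed
    qed
    show "lip_norm \<alpha> \<mu> (cz_ext \<mu> k T f) \<le> H * lip_norm \<alpha> \<mu> (mod_const \<mu> f)"
    proof (cases "H = 0")
      case True
      then show ?thesis using bd[OF L0] by simp
    next
      case False
      have "lip_norm \<alpha> \<mu> (cz_ext \<mu> k T f) / H \<le> Inf {C. 0 \<le> C \<and> lip_bound \<alpha> \<mu> f C}"
        by (rule cInf_greatest) (use L0 bd H False in \<open>auto simp: field_simps\<close>)
      then show ?thesis unfolding lip_norm_mod_const[OF sets_mu f] using H False by (simp add: field_simps)
    qed
  qed
qed

end

lemma (in growth_measure) bounded_on_Lip_imp_T1:
  fixes K :: "'a \<Rightarrow> 'a \<Rightarrow> 'k::{real_normed_field, banach, second_countable_topology}"
  assumes alpha: "0 < \<alpha>" and bdd: "bounded_on_Lip \<alpha> \<mu> K T"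
  shows "cz_ext \<mu> K T (\<lambda>_. 1) = mod_const \<mu> (\<lambda>_. 0)"
proof -
  have lb: "lip_bound \<alpha> \<mu> (\<lambda>_. 1::'k) 0" unfolding lip_bound_def by (intro bexI[of _ "{}"]) auto
  have one: "(\<lambda>_. 1::'k) \<in> lip_functions \<alpha> \<mu>"
    by (rule lip_bound_in_lip_functions[OF _ _ _ lb]) (use alpha in auto)
  have le1: "lip_norm \<alpha> \<mu> (mod_const \<mu> (\<lambda>_. 1::'k)) \<le> 0"
    by (rule lip_norm_mod_const_le[OF sets_mu _ _ lb]) auto
  \<comment> \<open>The constant in \<open>bounded_on_Lip\<close> may be negative, so the norm of
    the class of 1 has to be exactly 0.\<close>
  have ge1: "0 \<le> lip_norm \<alpha> \<mu> (mod_const \<mu> (\<lambda>_. 1::'k))"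
    by (subst lip_norm_mod_const[OF sets_mu], simp, rule cInf_greatest) (use lb in auto)
  obtain C where C: "cz_ext \<mu> K T (\<lambda>_. 1) \<in> Lip \<alpha> \<mu>"
    "lip_norm \<alpha> \<mu> (cz_ext \<mu> K T (\<lambda>_. 1)) \<le> C * lip_norm \<alpha> \<mu> (mod_const \<mu> (\<lambda>_. 1::'k))"
    using bdd one unfolding bounded_on_Lip_def by blast
  have le: "lip_norm \<alpha> \<mu> (cz_ext \<mu> K T (\<lambda>_. 1)) \<le> 0" using C(2) le1 ge1 by (metis antisym mult_zero_right)
  obtain g where g: "g \<in> lip_functions \<alpha> \<mu>" "cz_ext \<mu> K T (\<lambda>_. 1) = mod_const \<mu> g"
    using C(1) unfolding Lip_def by blast
  obtain C1 where "g \<in> borel_measurable \<mu>" "0 \<le> C1" "lip_bound \<alpha> \<mu> g C1"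
    using g(1) by (auto simp: lip_functions_def loc_integrable_on_def set_borel_measurable_def)
  then show ?thesis using lip_norm_le_0_imp_const[OF sets_mu] le unfolding g(2) by blast
qed

section \<open>From the hypotheses of the theorem to the locales\<close>

lemma n_dimensional_growth_measure:
  fixes \<mu> :: "'a::euclidean_space measure"
  assumes "0 < n" "sets \<mu> = sets borel" "n_dimensional n \<mu>"
  shows "\<exists>A. growth_measure \<mu> n A"
proof -
  obtain C where C: "\<And>x r. 0 < r \<Longrightarrow> emeasure \<mu> (ball x r) \<le> ennreal (C * r powr n)"
    using assms(3) unfolding n_dimensional_def by blast
  have le: "ennreal (C * r powr n) \<le> ennreal (max C 0 * r powr n)" for r :: real
    by (intro ennreal_leI mult_right_mono) auto
  have "growth_measure \<mu> n (max C 0)"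
  proof
    show "emeasure \<mu> (ball x r) \<le> ennreal (max C 0 * r powr n)" if "0 < r" for x r
      by (rule order_trans[OF C[OF that] le])
  qed (use assms in auto)
  then show ?thesis by blast
qed

lemma cz_operator_cz_setup:
  fixes K :: "'a::euclidean_space \<Rightarrow> 'a \<Rightarrow> 'k::{real_normed_field, banach, second_countable_topology}"
  assumes gm: "growth_measure \<mu> n A" and eps: "0 < \<epsilon>" and cz: "cz_operator n \<epsilon> \<mu> K T"
  shows "\<exists>M N. cz_setup \<mu> n A (\<lambda>x y. if x = y then 0 else K x y) T \<epsilon> M N"
proof -
  interpret growth_measure \<mu> n A by (rule gm)
  define k where "k x y = (if x = y then 0 else K x y)" for x y
  have std: "standard_kernel n \<epsilon> \<mu> K" and bl: "bounded_linear_L2 \<mu> T"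
    and rep: "\<And>f. f \<in> L2 \<mu> \<Longrightarrow> compact (fsupport f) \<Longrightarrow>
        AE x in \<mu>. x \<notin> fsupport f \<longrightarrow> T f x = (\<integral>y. K x y * f y \<partial>\<mu>)"
    using cz unfolding cz_operator_def by auto
  obtain M where M: "0 < M" "\<And>x y. x \<noteq> y \<Longrightarrow> norm (K x y) \<le> M / dist x y powr n"
    "\<And>x x' y. x \<noteq> y \<Longrightarrow> 2 * dist x x' \<le> dist x y \<Longrightarrow>
       norm (K x y - K x' y) \<le> M * (dist x x' powr \<epsilon> / dist x y powr (n + \<epsilon>))"
    using std unfolding standard_kernel_def by blast
  obtain C where C: "\<And>f. f \<in> L2 \<mu> \<Longrightarrow> L2_norm \<mu> (T f) \<le> C * L2_norm \<mu> f"
    using bl unfolding bounded_linear_L2_def by blast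
  \<comment> \<open>The L2 bound enters in squared form; adding 1 to the absolute value makes
    \<open>N\<close> positive for every \<open>C\<close>.\<close>
  define N where "N = (\<bar>C\<bar> + 1)\<^sup>2"
  have "cz_setup \<mu> n A k T \<epsilon> M N"
  proof unfold_locales
    \<comment> \<open>Local integrability off the diagonal includes measurability of
      \<open>K\<close> cut off to that set, and this cut-off is \<open>k\<close>.\<close>
    have "(\<lambda>z. indicator {(x, y). x \<noteq> y} z *\<^sub>R (case z of (x, y) \<Rightarrow> K x y)) \<in> borel_measurable (\<mu> \<Otimes>\<^sub>M \<mu>)"
      using std unfolding standard_kernel_def loc_integrable_on_def set_borel_measurable_def by blast
    also have "(\<lambda>z. indicator {(x, y). x \<noteq> y} z *\<^sub>R (case z of (x, y) \<Rightarrow> K x y)) = (\<lambda>(x, y). k x y)"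
      by (auto simp: k_def fun_eq_iff)
    finally show "(\<lambda>(x, y). k x y) \<in> borel_measurable (\<mu> \<Otimes>\<^sub>M \<mu>)" .
    show "norm (k x y) \<le> M * dist x y powr (- n)" if "x \<noteq> y" for x y
      using M(2)[OF that] that by (simp add: k_def powr_minus_divide)
    show "norm (k x y - k x' y) \<le> M * dist x x' powr \<epsilon> * dist x y powr (- n - \<epsilon>)"
      if *: "x \<noteq> y" "2 * dist x x' \<le> dist x y" for x x' y
    proof -
      have "x' \<noteq> y" using * by auto
      moreover have "dist x y powr (- n - \<epsilon>) = 1 / dist x y powr (n + \<epsilon>)"
        unfolding powr_minus_divide[symmetric] by (simp only: minus_add_distrib diff_conv_add_uminus)
      ultimately show ?thesis using M(3)[OF *] * by (simp add: k_def)
    qed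
    show "T f \<in> L2 \<mu>" if "f \<in> L2 \<mu>" for f using bl that unfolding bounded_linear_L2_def by blast
    show "AE x in \<mu>. T (\<lambda>y. f y + g y) x = T f x + T g x" if "f \<in> L2 \<mu>" "g \<in> L2 \<mu>" for f g
      using bl that unfolding bounded_linear_L2_def by blast
    show "AE x in \<mu>. T (\<lambda>y. a * f y) x = a * T f x" if "f \<in> L2 \<mu>" for f a
      using bl that unfolding bounded_linear_L2_def by blast
    show "(\<integral>x. (norm (T f x))\<^sup>2 \<partial>\<mu>) \<le> N * (\<integral>x. (norm (f x))\<^sup>2 \<partial>\<mu>)" if "f \<in> L2 \<mu>" for f
    proof -
      have nn: "0 \<le> (\<integral>x. (norm (g x))\<^sup>2 \<partial>\<mu>)" for g :: "'a \<Rightarrow> 'k" by (rule Bochner_Integration.integral_nonneg) simp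
      have "L2_norm \<mu> (T f) \<le> C * L2_norm \<mu> f" by (rule C[OF that])
      also have "\<dots> \<le> (\<bar>C\<bar> + 1) * L2_norm \<mu> f" by (rule mult_right_mono) (auto simp: L2_norm_def nn)
      finally have "(L2_norm \<mu> (T f))\<^sup>2 \<le> ((\<bar>C\<bar> + 1) * L2_norm \<mu> f)\<^sup>2"
        by (rule power_mono) (simp add: L2_norm_def nn)
      then show ?thesis using nn by (simp add: L2_norm_def N_def power_mult_distrib)
    qed
    show "AE x in \<mu>. x \<notin> fsupport f \<longrightarrow> T f x = (\<integral>y. k x y * f y \<partial>\<mu>)"
      if "f \<in> L2 \<mu>" "compact (fsupport f)" for f
      using rep[OF that]
    proof (rule eventually_mono, intro impI)
      fix x assume *: "x \<notin> fsupport f \<longrightarrow> T f x = (\<integral>y. K x y * f y \<partial>\<mu>)" "x \<notin> fsupport f"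
      \<comment> \<open>On the diagonal the kernel is multiplied by f(x), which vanishes off the
        support.\<close>
      have "x \<notin> {y. f y \<noteq> 0}"
        using *(2) closure_subset[of "{y. f y \<noteq> 0}"] unfolding fsupport_def by blast
      then have "f x = 0" by simp
      then have "(\<lambda>y. K x y * f y) = (\<lambda>y. k x y * f y)" by (auto simp: k_def fun_eq_iff)
      then show "T f x = (\<integral>y. k x y * f y \<partial>\<mu>)" using * by simp
    qed
  qed (use eps M(1) in \<open>auto simp: k_def N_def\<close>)
  then show ?thesis unfolding k_def by blast
qed

theorem theorem3p6:
  fixes \<mu> :: "'a::euclidean_space measure"
    and K :: "'a \<Rightarrow> 'a \<Rightarrow> 'k::{real_normed_field, banach, second_countable_topology}"
    and T :: "('a \<Rightarrow> 'k) \<Rightarrow> 'a \<Rightarrow> 'k"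
    and n \<epsilon> \<alpha> :: real
  assumes "0 < n" and "n \<le> real DIM('a)"
    and "radon_measure \<mu>" and "n_dimensional n \<mu>"
    and "0 < \<alpha>" and "\<alpha> < \<epsilon>" and "\<epsilon> \<le> 1"
    and "cz_operator n \<epsilon> \<mu> K T"
  shows "bounded_on_Lip \<alpha> \<mu> K T \<longleftrightarrow> cz_ext \<mu> K T (\<lambda>_. 1) = mod_const \<mu> (\<lambda>_. 0)"
proof
  have s: "sets \<mu> = sets borel" using assms(3) by (simp add: radon_measure_def)
  obtain A where gm: "growth_measure \<mu> n A"
    using n_dimensional_growth_measure[OF assms(1) s assms(4)] by blast
  then show "bounded_on_Lip \<alpha> \<mu> K T \<Longrightarrow> cz_ext \<mu> K T (\<lambda>_. 1) = mod_const \<mu> (\<lambda>_. 0)"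
    using growth_measure.bounded_on_Lip_imp_T1[OF _ assms(5)] by blast
  assume T1: "cz_ext \<mu> K T (\<lambda>_. 1) = mod_const \<mu> (\<lambda>_. 0)"
  define k where "k x y = (if x = y then 0 else K x y)" for x y
  have ext: "cz_ext \<mu> K T f = cz_ext \<mu> k T f" for f
    by (rule cz_ext_off_diagonal) (simp add: k_def)
  obtain M N where cz: "cz_setup \<mu> n A k T \<epsilon> M N"
    using cz_operator_cz_setup[OF gm _ assms(8)] assms(5,6) unfolding k_def[abs_def] by force
  then interpret cz_setup \<mu> n A k T \<epsilon> M N .
  \<comment> \<open>Membership of 0 in the class T(1) says that \<open>T1 p r\<close> is a.e.
    constant on each ball; the constant is the negative of the one in \<open>cz_ext\<close>, which
    explains the sign in the interpretation of \<open>cz_T1\<close>.\<close>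
  have "(\<lambda>_. 0) \<in> cz_ext \<mu> k T (\<lambda>_. 1)"
    unfolding ext[symmetric] T1 by (rule mod_const_self) simp
  then have "\<forall>p r. \<exists>a. p \<in> msupport \<mu> \<longrightarrow> 0 < r \<longrightarrow> (AE x in \<mu>. x \<in> ball p r \<longrightarrow> 0 = T1 p r x + a)"
    unfolding cz_ext_def cz_ball_one by blast
  then obtain a where a: "\<And>p r. p \<in> msupport \<mu> \<Longrightarrow> 0 < r \<Longrightarrow> AE x in \<mu>. x \<in> ball p r \<longrightarrow> 0 = T1 p r x + a p r"
    by metis
  interpret cz_T1 \<mu> n A k T \<epsilon> M N "\<lambda>p r. - a p r"
    by unfold_locales (rule eventually_mono[OF a], auto simp: eq_neg_iff_add_eq_0)
  show "bounded_on_Lip \<alpha> \<mu> K T"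
    using bounded_on_Lip[OF assms(5,6)] unfolding bounded_on_Lip_def ext .
qed

end
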